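(* Let $n\ge 1$ and let $(L_x)_{x\in S}$ be an $S$-glued system in which every $L_x$ is $n$-distributive. Then its $S$-glued sum $L$ is $n$-distributive.
   Context: Let $S$ be a lattice of finite length (every chain in $S$ is finite), with order $\le$, join $\vee$ and meet $\wedge$; $x\prec y$ means that $y$ covers $x$. An \emph{$S$-glued system} is a family $(L_x,\le_x)_{x\in S}$ of lattices of finite length (with join $+_x$, meet $\cdot_x$, least element $0_x$, greatest element $1_x$), whose underlying sets may overlap, such that for all $x,y\in S$: (1) if $x\le y$ and $L_x\cap L_y\ne\emptyset$, then $L_x\cap L_y$ is a filter of $L_x$ and an ideal of $L_y$; (2) in the situation of (1), for all $a,b\in L_x\cap L_y$: $a\le_x b$ iff $a\le_y b$; (3) if $x\prec y$ then $L_x\cap L_y\ne\emptyset$; (4) $L_x\cap L_y\subseteq L_{x\wedge y}\cap L_{x\vee y}$. The \emph{$S$-glued sum} of the system is the set $L=\bigcup_{x\in S}L_x$ equipped with the relation $\le$ defined as the transitive closure of $\bigcup_{x\in S}\le_x$; it is a lattice. A lattice $K$ (join $+$, meet $\cdot$) is \emph{$n$-distributive} if it is modular and satisfies the identity $x\cdot\sum_{i=0}^n y_i=\sum_{j=0}^n\big(x\cdot\sum_{i=0,\,i\ne j}^n y_i\big)$. *)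

theory Defs
  imports Main
begin

definition partial_order_on' :: "'a set \<Rightarrow> ('a \<Rightarrow> 'a \<Rightarrow> bool) \<Rightarrow> bool" where
  "partial_order_on' A le \<longleftrightarrow>
     (\<forall>a\<in>A. le a a) \<and>
     (\<forall>a\<in>A. \<forall>b\<in>A. le a b \<and> le b a \<longrightarrow> a = b) \<and>
     (\<forall>a\<in>A. \<forall>b\<in>A. \<forall>c\<in>A. le a b \<and> le b c \<longrightarrow> le a c)"

definition is_lub_on :: "'a set \<Rightarrow> ('a \<Rightarrow> 'a \<Rightarrow> bool) \<Rightarrow> 'a \<Rightarrow> 'a \<Rightarrow> 'a \<Rightarrow> bool" where
  "is_lub_on A le a b c \<longleftrightarrow> c \<in> A \<and> le a c \<and> le b c \<and>
     (\<forall>d\<in>A. le a d \<and> le b d \<longrightarrow> le c d)"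

definition is_glb_on :: "'a set \<Rightarrow> ('a \<Rightarrow> 'a \<Rightarrow> bool) \<Rightarrow> 'a \<Rightarrow> 'a \<Rightarrow> 'a \<Rightarrow> bool" where
  "is_glb_on A le a b c \<longleftrightarrow> c \<in> A \<and> le c a \<and> le c b \<and>
     (\<forall>d\<in>A. le d a \<and> le d b \<longrightarrow> le d c)"

definition lattice_on :: "'a set \<Rightarrow> ('a \<Rightarrow> 'a \<Rightarrow> bool) \<Rightarrow> bool" where
  "lattice_on A le \<longleftrightarrow> partial_order_on' A le \<and>
     (\<forall>a\<in>A. \<forall>b\<in>A. (\<exists>c. is_lub_on A le a b c) \<and> (\<exists>c. is_glb_on A le a b c))"

text \<open>Join and meet (meaningful when lattice_on A le holds).\<close>
definition join_on :: "'a set \<Rightarrow> ('a \<Rightarrow> 'a \<Rightarrow> bool) \<Rightarrow> 'a \<Rightarrow> 'a \<Rightarrow> 'a" where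
  "join_on A le a b = (THE c. is_lub_on A le a b c)"

definition meet_on :: "'a set \<Rightarrow> ('a \<Rightarrow> 'a \<Rightarrow> bool) \<Rightarrow> 'a \<Rightarrow> 'a \<Rightarrow> 'a" where
  "meet_on A le a b = (THE c. is_glb_on A le a b c)"

definition finite_length_on :: "'a set \<Rightarrow> ('a \<Rightarrow> 'a \<Rightarrow> bool) \<Rightarrow> bool" where
  "finite_length_on A le \<longleftrightarrow>
     (\<forall>X. X \<subseteq> A \<and> (\<forall>a\<in>X. \<forall>b\<in>X. le a b \<or> le b a) \<longrightarrow> finite X)"

definition is_filter_on :: "'a set \<Rightarrow> ('a \<Rightarrow> 'a \<Rightarrow> bool) \<Rightarrow> 'a set \<Rightarrow> bool" where
  "is_filter_on A le F \<longleftrightarrow> F \<subseteq> A \<and> F \<noteq> {} \<and>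
     (\<forall>a\<in>F. \<forall>b\<in>A. le a b \<longrightarrow> b \<in> F) \<and>
     (\<forall>a\<in>F. \<forall>b\<in>F. meet_on A le a b \<in> F)"

definition is_ideal_on :: "'a set \<Rightarrow> ('a \<Rightarrow> 'a \<Rightarrow> bool) \<Rightarrow> 'a set \<Rightarrow> bool" where
  "is_ideal_on A le I \<longleftrightarrow> I \<subseteq> A \<and> I \<noteq> {} \<and>
     (\<forall>a\<in>I. \<forall>b\<in>A. le b a \<longrightarrow> b \<in> I) \<and>
     (\<forall>a\<in>I. \<forall>b\<in>I. join_on A le a b \<in> I)"

definition modular_on :: "'a set \<Rightarrow> ('a \<Rightarrow> 'a \<Rightarrow> bool) \<Rightarrow> bool" where
  "modular_on A le \<longleftrightarrow> (\<forall>a\<in>A. \<forall>b\<in>A. \<forall>c\<in>A. le a c \<longrightarrow>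
     join_on A le a (meet_on A le b c) = meet_on A le (join_on A le a b) c)"

fun big_join_on :: "'a set \<Rightarrow> ('a \<Rightarrow> 'a \<Rightarrow> bool) \<Rightarrow> 'a list \<Rightarrow> 'a" where
  "big_join_on A le [] = undefined"
| "big_join_on A le [a] = a"
| "big_join_on A le (a # b # xs) = join_on A le a (big_join_on A le (b # xs))"

definition n_distributive_on :: "'a set \<Rightarrow> ('a \<Rightarrow> 'a \<Rightarrow> bool) \<Rightarrow> nat \<Rightarrow> bool" where
  "n_distributive_on A le n \<longleftrightarrow> lattice_on A le \<and> modular_on A le \<and>
     (\<forall>x\<in>A. \<forall>y. (\<forall>i\<le>n. y i \<in> A) \<longrightarrow>
        meet_on A le x (big_join_on A le (map y [0..<Suc n])) =
        big_join_on A le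
          (map (\<lambda>j. meet_on A le x (big_join_on A le (map y (filter (\<lambda>i. i \<noteq> j) [0..<Suc n]))))
               [0..<Suc n]))"

definition covers :: "'s::order \<Rightarrow> 's \<Rightarrow> bool" where
  "covers x y \<longleftrightarrow> x < y \<and> \<not> (\<exists>z. x < z \<and> z < y)"

definition glued_system :: "('s::lattice \<Rightarrow> 'a set) \<Rightarrow> ('s \<Rightarrow> 'a \<Rightarrow> 'a \<Rightarrow> bool) \<Rightarrow> bool" where
  "glued_system C R \<longleftrightarrow>
     (\<forall>x. lattice_on (C x) (R x) \<and> finite_length_on (C x) (R x)) \<and>
     (\<forall>x y. x \<le> y \<and> C x \<inter> C y \<noteq> {} \<longrightarrow>
        is_filter_on (C x) (R x) (C x \<inter> C y) \<and> is_ideal_on (C y) (R y) (C x \<inter> C y)) \<and>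
     (\<forall>x y. x \<le> y \<and> C x \<inter> C y \<noteq> {} \<longrightarrow>
        (\<forall>a\<in>C x \<inter> C y. \<forall>b\<in>C x \<inter> C y. R x a b \<longleftrightarrow> R y a b)) \<and>
     (\<forall>x y. covers x y \<longrightarrow> C x \<inter> C y \<noteq> {}) \<and>
     (\<forall>x y. C x \<inter> C y \<subseteq> C (inf x y) \<inter> C (sup x y))"

definition glued_carrier :: "('s \<Rightarrow> 'a set) \<Rightarrow> 'a set" where
  "glued_carrier C = (\<Union>x. C x)"

definition glued_le :: "('s \<Rightarrow> 'a set) \<Rightarrow> ('s \<Rightarrow> 'a \<Rightarrow> 'a \<Rightarrow> bool) \<Rightarrow> 'a \<Rightarrow> 'a \<Rightarrow> bool" where
  "glued_le C R = tranclp (\<lambda>a b. \<exists>x. a \<in> C x \<and> b \<in> C x \<and> R x a b)"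

end

theory Submission
  imports Defs
begin

text \<open>
  A chain in the glued sum can be rerouted so that the indices of the blocks it passes through
  ascend. Hence blocks are convex sublattices, and the glued sum is a lattice satisfying both chain
  conditions. Among the blocks containing \<open>d\<close>, one with maximal index contains all
  upper covers of \<open>d\<close>; dually for lower covers. So it suffices to test both properties on the
  covers of a single element. For modularity these are the two semimodularity conditions. For
  \<open>n\<close>-distributivity, take \<open>d\<close> maximal such that the identity fails above \<open>d\<close>, and a minimal
  \<open>p \<ge> d\<close> witnessing this: \<open>p \<le> y\<^sub>0 + \<dots> + y\<^sub>n\<close>, but \<open>p\<close> is not below the join of the \<open>y\<^sub>i\<close>
  with \<open>i \<noteq> j\<close>, for any \<open>j\<close>. The identity above each atom \<open>q \<noteq> p\<close> over \<open>d\<close> shows that \<open>p\<close> is below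
  the join of \<open>q\<close> and the \<open>y\<^sub>i\<close> with \<open>i \<noteq> j\<close>, for some \<open>j\<close>. It follows that \<open>p\<close> is itself an
  atom over \<open>d\<close> and that every \<open>y\<^sub>i\<close> can be replaced by an atom below it, so that the
  identity already fails inside one block.
\<close>

section \<open>Lattices on a carrier set\<close>

text \<open>Membership in \<open>A\<close> is part of the relation, so that its well-foundedness
  over the whole type is the descending chain condition on \<open>A\<close>; for the reversed order
  it is the ascending one.\<close>

definition strict_on :: "'a set \<Rightarrow> ('a \<Rightarrow> 'a \<Rightarrow> bool) \<Rightarrow> 'a \<Rightarrow> 'a \<Rightarrow> bool" where
  "strict_on A le a b \<longleftrightarrow> a \<in> A \<and> b \<in> A \<and> le a b \<and> a \<noteq> b"

section \<open>Order duality, by which only one half of each dual pair of facts has to be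
  proved\<close>

lemma is_lub_on_dual: "is_lub_on A (\<lambda>a b. le b a) = is_glb_on A le"
  by (intro ext) (auto simp: is_lub_on_def is_glb_on_def)

lemma is_glb_on_dual: "is_glb_on A (\<lambda>a b. le b a) = is_lub_on A le"
  by (intro ext) (auto simp: is_lub_on_def is_glb_on_def)

lemma join_on_dual: "join_on A (\<lambda>a b. le b a) = meet_on A le"
  by (intro ext) (simp add: join_on_def meet_on_def is_lub_on_dual)

lemma meet_on_dual: "meet_on A (\<lambda>a b. le b a) = join_on A le"
  by (intro ext) (simp add: join_on_def meet_on_def is_glb_on_dual)

lemma partial_order_on'_dual:
  "partial_order_on' A le \<Longrightarrow> partial_order_on' A (\<lambda>a b. le b a)"
  unfolding partial_order_on'_def by blast

lemma lattice_on_dual: "lattice_on A le \<Longrightarrow> lattice_on A (\<lambda>a b. le b a)"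
  unfolding lattice_on_def is_lub_on_dual[of A le] is_glb_on_dual[of A le]
  using partial_order_on'_dual by blast

lemma finite_length_on_dual: "finite_length_on A le \<Longrightarrow> finite_length_on A (\<lambda>a b. le b a)"
  unfolding finite_length_on_def by blast

text \<open>The range of an infinite strictly descending sequence would be an infinite
  chain.\<close>

lemma finite_length_on_wfp:
  assumes po: "partial_order_on' A le" and fin: "finite_length_on A le"
  shows "wfp (strict_on A le)"
  unfolding wfp_def wf_iff_no_infinite_down_chain
proof
  assume "\<exists>f. \<forall>i. (f (Suc i), f i) \<in> {(a, b). strict_on A le a b}"
  then obtain f where f: "\<And>i. strict_on A le (f (Suc i)) (f i)"
    by blast
  have A: "f i \<in> A" for i
    using f by (simp add: strict_on_def)
  have tr: "le a b \<Longrightarrow> le b c \<Longrightarrow> a \<in> A \<Longrightarrow> b \<in> A \<Longrightarrow> c \<in> A \<Longrightarrow> le a c" for a b c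
    using po unfolding partial_order_on'_def by blast
  have anti: "le a b \<Longrightarrow> le b a \<Longrightarrow> a \<in> A \<Longrightarrow> b \<in> A \<Longrightarrow> a = b" for a b
    using po unfolding partial_order_on'_def by blast
  have refl: "a \<in> A \<Longrightarrow> le a a" for a
    using po unfolding partial_order_on'_def by blast
  have down: "le (f (i + k)) (f i)" for i k
  proof (induction k)
    case 0
    then show ?case using A refl by simp
  next
    case (Suc k)
    then show ?case
      using f[of "i + k"] tr[of "f (i + Suc k)" "f (i + k)" "f i"] A by (simp add: strict_on_def)
  qed
  have neq: "f i \<noteq> f j" if ij: "i < j" for i j
  proof
    assume eq: "f i = f j"
    obtain k where "j = Suc i + k"
      using less_imp_Suc_add[OF ij] by auto
    then have "le (f j) (f (Suc i))" using down[of "Suc i" k] by simp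
    moreover have "le (f (Suc i)) (f i)" "f (Suc i) \<noteq> f i"
      using f[of i] by (auto simp: strict_on_def)
    ultimately show False using anti A eq by metis
  qed
  have "inj f"
    by (rule injI) (metis neq linorder_neqE_nat)
  then have "infinite (range f)" using finite_imageD by blast
  moreover have "finite (range f)"
  proof -
    have "le (f i) (f j) \<or> le (f j) (f i)" for i j
      using down[of i "j - i"] down[of j "i - j"] by (cases "i \<le> j") auto
    then show ?thesis
      using fin[unfolded finite_length_on_def, rule_format, of "range f"] A by blast
  qed
  ultimately show False by blast
qed

locale carrier_lattice =
  fixes A :: "'a set" and le :: "'a \<Rightarrow> 'a \<Rightarrow> bool" (infix "\<sqsubseteq>" 50)
  assumes lattice: "lattice_on A (\<sqsubseteq>)"
begin

abbreviation join (infixl "\<oplus>" 65) where "a \<oplus> b \<equiv> join_on A (\<sqsubseteq>) a b"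
abbreviation meet (infixl "\<otimes>" 70) where "a \<otimes> b \<equiv> meet_on A (\<sqsubseteq>) a b"

lemma dual: "carrier_lattice A (\<lambda>a b. b \<sqsubseteq> a)"
  by unfold_locales (rule lattice_on_dual[OF lattice])

lemma po: "partial_order_on' A (\<sqsubseteq>)"
  using lattice unfolding lattice_on_def by blast

lemma refl [simp]: "a \<in> A \<Longrightarrow> a \<sqsubseteq> a"
  using po unfolding partial_order_on'_def by blast

lemma antisym: "a \<sqsubseteq> b \<Longrightarrow> b \<sqsubseteq> a \<Longrightarrow> a \<in> A \<Longrightarrow> b \<in> A \<Longrightarrow> a = b"
  using po unfolding partial_order_on'_def by blast

lemma trans: "a \<sqsubseteq> b \<Longrightarrow> b \<sqsubseteq> c \<Longrightarrow> a \<in> A \<Longrightarrow> b \<in> A \<Longrightarrow> c \<in> A \<Longrightarrow> a \<sqsubseteq> c"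
  using po unfolding partial_order_on'_def by blast

lemma lub_unique: "is_lub_on A (\<sqsubseteq>) a b c \<Longrightarrow> is_lub_on A (\<sqsubseteq>) a b d \<Longrightarrow> c = d"
  using antisym unfolding is_lub_on_def by blast

lemma join_eqI: "is_lub_on A (\<sqsubseteq>) a b c \<Longrightarrow> a \<oplus> b = c"
  unfolding join_on_def using lub_unique by blast

lemma join_lub: "a \<in> A \<Longrightarrow> b \<in> A \<Longrightarrow> is_lub_on A (\<sqsubseteq>) a b (a \<oplus> b)"
  using lattice join_eqI unfolding lattice_on_def by metis

lemma meet_glb: "a \<in> A \<Longrightarrow> b \<in> A \<Longrightarrow> is_glb_on A (\<sqsubseteq>) a b (a \<otimes> b)"
  using carrier_lattice.join_lub[OF dual] unfolding is_lub_on_dual[of A "(\<sqsubseteq>)"] join_on_dual[of A "(\<sqsubseteq>)"] .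

lemma meet_eqI: "is_glb_on A (\<sqsubseteq>) a b c \<Longrightarrow> a \<otimes> b = c"
  using carrier_lattice.join_eqI[OF dual] unfolding is_lub_on_dual[of A "(\<sqsubseteq>)"] join_on_dual[of A "(\<sqsubseteq>)"] .

lemma
  assumes "a \<in> A" "b \<in> A"
  shows join_closed [simp]: "a \<oplus> b \<in> A"
    and join_ge1 [simp]: "a \<sqsubseteq> a \<oplus> b"
    and join_ge2 [simp]: "b \<sqsubseteq> a \<oplus> b"
    and meet_closed [simp]: "a \<otimes> b \<in> A"
    and meet_le1 [simp]: "a \<otimes> b \<sqsubseteq> a"
    and meet_le2 [simp]: "a \<otimes> b \<sqsubseteq> b"
  using join_lub[OF assms] meet_glb[OF assms] by (auto simp: is_lub_on_def is_glb_on_def)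

lemma join_least: "a \<sqsubseteq> c \<Longrightarrow> b \<sqsubseteq> c \<Longrightarrow> a \<in> A \<Longrightarrow> b \<in> A \<Longrightarrow> c \<in> A \<Longrightarrow> a \<oplus> b \<sqsubseteq> c"
  using join_lub unfolding is_lub_on_def by blast

lemma meet_greatest: "c \<sqsubseteq> a \<Longrightarrow> c \<sqsubseteq> b \<Longrightarrow> a \<in> A \<Longrightarrow> b \<in> A \<Longrightarrow> c \<in> A \<Longrightarrow> c \<sqsubseteq> a \<otimes> b"
  using meet_glb unfolding is_glb_on_def by blast

lemma join_commute: "a \<oplus> b = b \<oplus> a"
  unfolding join_on_def is_lub_on_def by metis

lemma meet_commute: "a \<otimes> b = b \<otimes> a"
  unfolding meet_on_def is_glb_on_def by metis

lemma join_absorb: "a \<sqsubseteq> b \<Longrightarrow> a \<in> A \<Longrightarrow> b \<in> A \<Longrightarrow> a \<oplus> b = b"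
  by (rule join_eqI) (simp add: is_lub_on_def)

lemma meet_absorb: "a \<sqsubseteq> b \<Longrightarrow> a \<in> A \<Longrightarrow> b \<in> A \<Longrightarrow> a \<otimes> b = a"
  by (rule meet_eqI) (simp add: is_glb_on_def)

lemma join_mono:
  assumes "a \<sqsubseteq> a'" "b \<sqsubseteq> b'" "a \<in> A" "b \<in> A" "a' \<in> A" "b' \<in> A"
  shows "a \<oplus> b \<sqsubseteq> a' \<oplus> b'"
  using assms trans[of a a' "a' \<oplus> b'"] trans[of b b' "a' \<oplus> b'"] by (intro join_least) auto

definition lub :: "'a set \<Rightarrow> 'a \<Rightarrow> bool" where
  "lub X s \<longleftrightarrow> s \<in> A \<and> (\<forall>a\<in>X. a \<sqsubseteq> s) \<and> (\<forall>u\<in>A. (\<forall>a\<in>X. a \<sqsubseteq> u) \<longrightarrow> s \<sqsubseteq> u)"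

lemma big_join_lub:
  "xs \<noteq> [] \<Longrightarrow> set xs \<subseteq> A \<Longrightarrow> lub (set xs) (big_join_on A (\<sqsubseteq>) xs)"
proof (induction xs rule: induct_list012)
  case 1
  then show ?case by simp
next
  case (2 a)
  then show ?case by (auto simp: lub_def)
next
  case (3 a b xs)
  then have a: "a \<in> A" and IH: "lub (set (b # xs)) (big_join_on A (\<sqsubseteq>) (b # xs))" (is "lub _ ?s")
    by auto
  then have s: "?s \<in> A" "\<And>c. c \<in> set (b # xs) \<Longrightarrow> c \<sqsubseteq> ?s"
      "\<And>u. u \<in> A \<Longrightarrow> \<forall>c\<in>set (b # xs). c \<sqsubseteq> u \<Longrightarrow> ?s \<sqsubseteq> u"
    by (simp_all only: lub_def)
  have sub: "\<And>c. c \<in> set (b # xs) \<Longrightarrow> c \<in> A" using 3(4) by auto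
  have "c \<sqsubseteq> a \<oplus> ?s" if "c \<in> set (a # b # xs)" for c
  proof (cases "c = a")
    case False
    then have c: "c \<in> set (b # xs)" using that by simp
    show ?thesis
      by (rule trans[OF s(2)[OF c] _ sub[OF c]]) (use a s(1) in auto)
  qed (use a s(1) in simp)
  moreover have "a \<oplus> ?s \<sqsubseteq> u" if "u \<in> A" "\<forall>c\<in>set (a # b # xs). c \<sqsubseteq> u" for u
    by (rule join_least) (use that a s in auto)
  ultimately show ?case
    using a s(1) by (simp only: lub_def big_join_on.simps join_closed) blast
qed

text \<open>A list join depends only on the set of its entries; working with sets allows a direct
  comparison of joins over the index sets \<open>{..n}\<close> and
  \<open>{..n} - {j}\<close>.\<close>

definition Join :: "'a set \<Rightarrow> 'a" where
  "Join X = (THE s. lub X s)"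

lemma Join_eqI: "lub X s \<Longrightarrow> Join X = s"
  unfolding Join_def by (rule the_equality, assumption) (meson lub_def antisym)

lemma big_join_eq_Join: "xs \<noteq> [] \<Longrightarrow> set xs \<subseteq> A \<Longrightarrow> big_join_on A (\<sqsubseteq>) xs = Join (set xs)"
  using big_join_lub Join_eqI by metis

lemma lub_Join:
  assumes "finite X" "X \<noteq> {}" "X \<subseteq> A"
  shows "lub X (Join X)"
proof -
  obtain xs where "set xs = X" using finite_list[OF assms(1)] by blast
  then show ?thesis using big_join_lub[of xs] Join_eqI assms by fastforce
qed

lemma
  assumes "finite X" "X \<noteq> {}" "X \<subseteq> A"
  shows Join_closed: "Join X \<in> A"
    and Join_upper: "\<And>a. a \<in> X \<Longrightarrow> a \<sqsubseteq> Join X"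
    and Join_least: "\<And>u. u \<in> A \<Longrightarrow> (\<And>a. a \<in> X \<Longrightarrow> a \<sqsubseteq> u) \<Longrightarrow> Join X \<sqsubseteq> u"
  using lub_Join[OF assms] unfolding lub_def by blast+

section \<open>Covers under chain conditions\<close>

definition cover :: "'a \<Rightarrow> 'a \<Rightarrow> bool" where
  "cover a b \<longleftrightarrow> strict_on A (\<sqsubseteq>) a b \<and> (\<forall>c\<in>A. a \<sqsubseteq> c \<and> c \<sqsubseteq> b \<longrightarrow> c = a \<or> c = b)"

lemma coverD:
  assumes "cover a b"
  shows "a \<in> A" "b \<in> A" "a \<sqsubseteq> b" "a \<noteq> b"
    and "\<And>c. c \<in> A \<Longrightarrow> a \<sqsubseteq> c \<Longrightarrow> c \<sqsubseteq> b \<Longrightarrow> c = a \<or> c = b"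
  using assms unfolding cover_def strict_on_def by auto

lemma cover_dual: "carrier_lattice.cover A (\<lambda>a b. b \<sqsubseteq> a) = (\<lambda>a b. cover b a)"
  by (intro ext) (auto simp: carrier_lattice.cover_def[OF dual] cover_def strict_on_def)

text \<open>A minimal one among the elements strictly above \<open>a\<close> and below
  \<open>b\<close> covers \<open>a\<close>.\<close>

lemma ex_cover:
  assumes "wfp (strict_on A (\<sqsubseteq>))" "a \<in> A" "b \<in> A" "a \<sqsubseteq> b" "a \<noteq> b"
  obtains c where "cover a c" "c \<sqsubseteq> b"
proof -
  let ?Q = "{c. strict_on A (\<sqsubseteq>) a c \<and> c \<sqsubseteq> b}"
  have "b \<in> ?Q" using assms by (simp add: strict_on_def)
  then obtain c where c: "c \<in> ?Q" and min: "\<And>e. strict_on A (\<sqsubseteq>) e c \<Longrightarrow> e \<notin> ?Q"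
    using assms(1) unfolding wfp_eq_minimal by (metis (no_types, lifting))
  have "e = a \<or> e = c" if "e \<in> A" "a \<sqsubseteq> e" "e \<sqsubseteq> c" for e
    using min[of e] c that trans[of e c b] assms(3) by (auto simp: strict_on_def)
  then have "cover a c" using c by (simp add: cover_def)
  then show thesis using that c by simp
qed

text \<open>A minimal element \<open>z\<close> is least, since \<open>z \<otimes> a\<close> cannot
  lie strictly below it.\<close>

lemma ex_least:
  assumes "wfp (strict_on A (\<sqsubseteq>))" "A \<noteq> {}"
  obtains z where "z \<in> A" "\<And>a. a \<in> A \<Longrightarrow> z \<sqsubseteq> a"
proof -
  obtain z where z: "z \<in> A" and min: "\<And>e. strict_on A (\<sqsubseteq>) e z \<Longrightarrow> e \<notin> A"
    using assms unfolding wfp_eq_minimal by (metis ex_in_conv)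
  have "z \<sqsubseteq> a" if "a \<in> A" for a
    using min[of "z \<otimes> a"] z that meet_le2[OF z that] unfolding strict_on_def
    by (metis meet_closed meet_le1)
  then show thesis using that z by blast
qed

text \<open>Climb from \<open>d\<close> towards \<open>b\<close>: for a cover \<open>c\<close> of
  \<open>d\<close> below \<open>b\<close>, semimodularity turns the pair \<open>d\<close>,
  \<open>a\<close> into \<open>c\<close>, \<open>c \<oplus> a\<close>, with the same join with
  \<open>b\<close>. The ascending chain condition ends the climb at \<open>d = b\<close>.\<close>

lemma semimodular_strong:
  assumes acc: "wfp (strict_on A (\<lambda>a b. b \<sqsubseteq> a))" and dcc: "wfp (strict_on A (\<sqsubseteq>))"
    and semi: "\<And>d a b. cover d a \<Longrightarrow> cover d b \<Longrightarrow> a \<noteq> b \<Longrightarrow> cover a (a \<oplus> b)"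
    and "cover d a" "d \<sqsubseteq> b" "b \<in> A" "\<not> a \<sqsubseteq> b"
  shows "cover b (b \<oplus> a)"
  using assms(4-)
proof (induction d arbitrary: a rule: wfp_induct_rule[OF acc])
  case (1 d)
  note d = coverD[OF 1(2)]
  show ?case
  proof (cases "d = b")
    case True
    then show ?thesis using 1 d join_absorb by simp
  next
    case False
    obtain c where c: "cover d c" "c \<sqsubseteq> b"
      using ex_cover[OF dcc d(1) \<open>b \<in> A\<close> \<open>d \<sqsubseteq> b\<close> False] .
    note cA = coverD[OF c(1)]
    have "cover c (c \<oplus> a)" using semi[OF c(1) 1(2)] c 1 by metis
    moreover have "\<not> c \<oplus> a \<sqsubseteq> b"
      using 1 cA d trans[of a "c \<oplus> a" b] join_ge2[of c a] by (metis join_closed)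
    ultimately have "cover b (b \<oplus> (c \<oplus> a))"
      using 1(1)[of c "c \<oplus> a"] cA c 1 d by (simp add: strict_on_def)
    moreover have "b \<oplus> (c \<oplus> a) = b \<oplus> a"
    proof (rule antisym)
      show "b \<oplus> (c \<oplus> a) \<sqsubseteq> b \<oplus> a"
        using cA d c \<open>b \<in> A\<close> trans[of c b "b \<oplus> a"] by (intro join_least) auto
      show "b \<oplus> a \<sqsubseteq> b \<oplus> (c \<oplus> a)"
        using cA d \<open>b \<in> A\<close> by (intro join_mono) auto
    qed (use cA d \<open>b \<in> A\<close> in auto)
    ultimately show ?thesis by simp
  qed
qed

end

section \<open>Modularity from the two semimodularity conditions on covers\<close>

locale local_modular_lattice = carrier_lattice +
  assumes acc: "wfp (strict_on A (\<lambda>a b. b \<sqsubseteq> a))" and dcc: "wfp (strict_on A (\<sqsubseteq>))"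
    and semi_up: "\<And>d a b. cover d a \<Longrightarrow> cover d b \<Longrightarrow> a \<noteq> b \<Longrightarrow> cover a (a \<oplus> b)"
    and semi_down: "\<And>d a b. cover a d \<Longrightarrow> cover b d \<Longrightarrow> a \<noteq> b \<Longrightarrow> cover (a \<otimes> b) a"
begin

lemma cover_join: "cover d a \<Longrightarrow> d \<sqsubseteq> b \<Longrightarrow> b \<in> A \<Longrightarrow> \<not> a \<sqsubseteq> b \<Longrightarrow> cover b (b \<oplus> a)"
  by (rule semimodular_strong[OF acc dcc]) (blast intro: semi_up)+

lemma cover_meet: "cover a d \<Longrightarrow> b \<sqsubseteq> d \<Longrightarrow> b \<in> A \<Longrightarrow> \<not> b \<sqsubseteq> a \<Longrightarrow> cover (b \<otimes> a) b"
  using carrier_lattice.semimodular_strong[OF dual, of d a b] acc dcc semi_down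
  unfolding cover_dual join_on_dual[of A "(\<sqsubseteq>)"] by metis

text \<open>The hypotheses describe a pentagon whose long side contains the cover \<open>a\<close>,
  \<open>c\<close>. For a cover \<open>b'\<close> of \<open>a \<otimes> b\<close> below
  \<open>b\<close>, the elements \<open>a \<oplus> b'\<close> and \<open>c \<oplus> b'\<close> form
  with \<open>b\<close> another such pentagon, strictly higher up, so the ascending chain condition
  excludes it.\<close>

lemma no_cover_pentagon:
  assumes "cover a c" "b \<in> A" "c \<otimes> b \<sqsubseteq> a" "c \<sqsubseteq> a \<oplus> b"
  shows False
  using assms
proof (induction a arbitrary: c rule: wfp_induct_rule[OF acc])
  case (1 a)
  note ac = coverD[OF 1(2)]
  let ?d = "a \<otimes> b"
  have bA: "b \<in> A" by fact
  have d: "?d \<in> A" "?d \<sqsubseteq> a" "?d \<sqsubseteq> b" using ac bA by auto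
  have d_eq: "c \<otimes> b = ?d"
  proof (rule antisym)
    show "c \<otimes> b \<sqsubseteq> ?d" using ac bA 1 by (intro meet_greatest) auto
    show "?d \<sqsubseteq> c \<otimes> b" using ac bA trans[of ?d a c] by (intro meet_greatest) auto
  qed (use ac bA in auto)
  have "?d \<noteq> b"
  proof
    assume "?d = b"
    then have "b \<sqsubseteq> a" using d by simp
    then have "a \<oplus> b = a" using join_absorb[of b a] ac bA join_commute by metis
    then show False using 1 ac antisym by metis
  qed
  then obtain b' where b': "cover ?d b'" "b' \<sqsubseteq> b"
    using ex_cover[OF dcc d(1) bA d(3)] by metis
  note b'A = coverD[OF b'(1)]
  have not_below: "\<not> b' \<sqsubseteq> c"
  proof
    assume "b' \<sqsubseteq> c"
    then have "b' \<sqsubseteq> c \<otimes> b" using b'A ac bA b' by (intro meet_greatest) auto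
    then show False using d_eq b'A antisym by metis
  qed
  have dc: "?d \<sqsubseteq> c" using trans[of ?d a c] ac d by blast
  have ab': "cover a (a \<oplus> b')"
    using cover_join[OF b'(1) d(2)] ac not_below b'A trans[of b' a c] by blast
  have cb': "cover c (c \<oplus> b')"
    using cover_join[OF b'(1) dc] ac not_below by blast
  let ?a = "a \<oplus> b'" and ?c = "c \<oplus> b'"
  have aA: "?a \<in> A" "?c \<in> A" using ac b'A by auto
  have "\<not> c \<sqsubseteq> ?a"
  proof
    assume "c \<sqsubseteq> ?a"
    then have "c = ?a" using coverD(5)[OF ab' ac(2) ac(3)] ac(4) by auto
    then show False using not_below ac b'A by (metis join_ge2)
  qed
  then have "cover ?a (?a \<oplus> c)"
    using cover_join[OF 1(2), of ?a] ac b'A aA by simp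
  moreover have "?a \<oplus> c = ?c"
  proof (rule antisym)
    show "?a \<oplus> c \<sqsubseteq> ?c" using ac b'A trans[of a c ?c] by (intro join_least) auto
    show "?c \<sqsubseteq> ?a \<oplus> c"
      using ac b'A trans[of b' ?a "?a \<oplus> c"] by (intro join_least) auto
  qed (use ac b'A in auto)
  ultimately have cov: "cover ?a ?c" by simp
  \<comment> \<open>Lower semimodularity enters here: a meet \<open>?t\<close> not below
    \<open>?a\<close> would cover \<open>?t \<otimes> c = ?d\<close>. As \<open>b'\<close> lies
    between \<open>?d\<close> and \<open>?t\<close>, it would equal \<open>?t\<close>, although
    \<open>b'\<close> is below \<open>?a\<close>.\<close>
  have "?c \<otimes> b \<sqsubseteq> ?a"
  proof (rule ccontr)
    let ?t = "?c \<otimes> b"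
    assume nt: "\<not> ?t \<sqsubseteq> ?a"
    have t: "?t \<in> A" "?t \<sqsubseteq> ?c" "?t \<sqsubseteq> b" using aA bA by auto
    have b't: "b' \<sqsubseteq> ?t" using aA bA ac b'A b' by (intro meet_greatest) auto
    have "\<not> ?t \<sqsubseteq> c" using not_below trans[OF b't] b'A t ac by blast
    then have "cover (?t \<otimes> c) ?t" using cover_meet[OF cb'] t by blast
    moreover have "?t \<otimes> c = ?d"
    proof (rule antisym)
      show "?t \<otimes> c \<sqsubseteq> ?d"
        unfolding d_eq[symmetric]
        using t ac bA trans[of "?t \<otimes> c" ?t b] by (intro meet_greatest) auto
      show "?d \<sqsubseteq> ?t \<otimes> c"
        using trans[OF b'A(3) b't] b'A t(1) ac(2) dc d(1) by (blast intro: meet_greatest)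
    qed (use t ac bA in auto)
    ultimately have "b' = ?t" using coverD(5)[of ?d ?t b'] b'A b't by metis
    then show False using nt ac b'A by (metis join_ge2)
  qed
  moreover have "?c \<sqsubseteq> ?a \<oplus> b"
  proof (rule join_least)
    show "c \<sqsubseteq> ?a \<oplus> b"
      using trans[OF \<open>c \<sqsubseteq> a \<oplus> b\<close>] ac aA bA b'A by (simp add: join_mono)
    show "b' \<sqsubseteq> ?a \<oplus> b"
      using b' b'A bA aA trans[of b' b "?a \<oplus> b"] by simp
  qed (use ac aA bA b'A in auto)
  ultimately show False
    using 1(1)[of ?a ?c] cov bA coverD[OF ab'] by (simp add: strict_on_def)
qed

text \<open>If the sides differed, the left one, an element \<open>e\<close> covering it below the
  right one, and \<open>b\<close> would form an excluded pentagon.\<close>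

lemma modular:
  assumes A: "a \<in> A" "b \<in> A" "c \<in> A" and ac: "a \<sqsubseteq> c"
  shows "a \<oplus> b \<otimes> c = (a \<oplus> b) \<otimes> c"
proof (rule ccontr)
  let ?l = "a \<oplus> b \<otimes> c" and ?r = "(a \<oplus> b) \<otimes> c"
  assume "?l \<noteq> ?r"
  have lr: "?l \<sqsubseteq> ?r"
    using A ac trans[of "b \<otimes> c" b "a \<oplus> b"] by (intro join_least meet_greatest) auto
  then obtain e where e: "cover ?l e" "e \<sqsubseteq> ?r"
    using ex_cover[OF dcc _ _ lr \<open>?l \<noteq> ?r\<close>] A by auto
  note eA = coverD[OF e(1)]
  have "e \<sqsubseteq> c" "e \<sqsubseteq> a \<oplus> b"
    using trans[OF e(2)] eA A by auto
  then have "e \<otimes> b \<sqsubseteq> b \<otimes> c"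
    using A eA trans[of "e \<otimes> b" e c] by (intro meet_greatest) auto
  then have "e \<otimes> b \<sqsubseteq> ?l"
    using trans[of "e \<otimes> b" "b \<otimes> c" ?l] A eA by simp
  moreover have "e \<sqsubseteq> ?l \<oplus> b"
    using trans[OF \<open>e \<sqsubseteq> a \<oplus> b\<close>] A eA by (simp add: join_mono)
  ultimately show False
    using no_cover_pentagon[OF e(1)] A by blast
qed

lemma modular_on: "modular_on A (\<sqsubseteq>)"
  unfolding modular_on_def using modular by blast

end

section \<open>Reduction of \<open>n\<close>-distributivity to atoms\<close>

text \<open>The place where \<open>n \<ge> 1\<close> enters: after one index is omitted another
  remains, so the partial joins are joins of nonempty families.\<close>

lemma others_nonempty:
  fixes n j :: nat
  assumes "n \<ge> 1"
  shows "{..n} - {j} \<noteq> {}"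
proof -
  have "(if j = 0 then n else 0) \<in> {..n} - {j}" using assms by simp
  then show ?thesis by blast
qed

context carrier_lattice
begin

text \<open>When \<open>p\<close> covers \<open>d\<close>, this is a failure of the identity at
  \<open>x = p\<close>: the meet with the full join is \<open>p\<close>, while every meet with a
  partial join is \<open>d\<close>.\<close>

definition minimally_spanned :: "nat \<Rightarrow> 'a \<Rightarrow> 'a \<Rightarrow> (nat \<Rightarrow> 'a) \<Rightarrow> bool" where
  "minimally_spanned n d p y \<longleftrightarrow> (\<forall>i\<le>n. y i \<in> A \<and> d \<sqsubseteq> y i) \<and> p \<sqsubseteq> Join (y ` {..n}) \<and>
     (\<forall>j\<le>n. \<not> p \<sqsubseteq> Join (y ` ({..n} - {j})))"

text \<open>Only the inequality that can fail is recorded. The restriction to elements above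
  \<open>d\<close> makes an induction on \<open>d\<close> from the top possible.\<close>

definition n_distributive_above :: "nat \<Rightarrow> 'a \<Rightarrow> bool" where
  "n_distributive_above n d \<longleftrightarrow> (\<forall>x\<in>A. \<forall>y. d \<sqsubseteq> x \<longrightarrow> (\<forall>i\<le>n. y i \<in> A \<and> d \<sqsubseteq> y i) \<longrightarrow>
     x \<otimes> Join (y ` {..n}) \<sqsubseteq> Join ((\<lambda>j. x \<otimes> Join (y ` ({..n} - {j}))) ` {..n}))"

lemma
  assumes "finite I" "I \<noteq> {}" "\<And>i. i \<in> I \<Longrightarrow> y i \<in> A"
  shows JOIN_closed: "Join (y ` I) \<in> A"
    and JOIN_upper: "\<And>i. i \<in> I \<Longrightarrow> y i \<sqsubseteq> Join (y ` I)"
    and JOIN_least: "\<And>u. u \<in> A \<Longrightarrow> (\<And>i. i \<in> I \<Longrightarrow> y i \<sqsubseteq> u) \<Longrightarrow> Join (y ` I) \<sqsubseteq> u"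
proof -
  have I: "finite (y ` I)" "y ` I \<noteq> {}" "y ` I \<subseteq> A" using assms by auto
  show "Join (y ` I) \<in> A" by (rule Join_closed[OF I])
  show "y i \<sqsubseteq> Join (y ` I)" if "i \<in> I" for i by (rule Join_upper[OF I]) (use that in simp)
  show "Join (y ` I) \<sqsubseteq> u" if "u \<in> A" "\<And>i. i \<in> I \<Longrightarrow> y i \<sqsubseteq> u" for u
    by (rule Join_least[OF I]) (use that in auto)
qed

lemma JOIN_le_trans:
  assumes "finite I" "\<And>i. i \<in> I \<Longrightarrow> y i \<in> A" "i \<in> I" "a \<sqsubseteq> y i" "a \<in> A"
  shows "a \<sqsubseteq> Join (y ` I)"
proof -
  have "I \<noteq> {}" using assms by blast
  then show ?thesis
    using trans[OF \<open>a \<sqsubseteq> y i\<close> JOIN_upper[of I y i]] JOIN_closed[of I y] assms by blast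
qed

lemma JOIN_mono:
  assumes "finite I" "I \<noteq> {}" "\<And>i. i \<in> I \<Longrightarrow> y i \<in> A" "\<And>i. i \<in> I \<Longrightarrow> z i \<in> A"
    and "\<And>i. i \<in> I \<Longrightarrow> y i \<sqsubseteq> z i"
  shows "Join (y ` I) \<sqsubseteq> Join (z ` I)"
proof (rule JOIN_least)
  show "Join (z ` I) \<in> A" by (rule JOIN_closed) (use assms in auto)
  show "y i \<sqsubseteq> Join (z ` I)" if "i \<in> I" for i
    by (rule JOIN_le_trans[of _ _ i]) (use assms that in auto)
qed (use assms in auto)

lemma big_join_map:
  assumes "xs \<noteq> []" "\<And>i. i \<in> set xs \<Longrightarrow> y i \<in> A"
  shows "big_join_on A (\<sqsubseteq>) (map y xs) = Join (y ` set xs)"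
  using big_join_eq_Join[of "map y xs"] assms by (simp add: image_subset_iff)

text \<open>Passes between the list form of the identity in \<open>n_distributive_on\<close> and
  joins over index sets.\<close>

lemma n_distributive_identity:
  assumes n: "n \<ge> 1" and x: "x \<in> A" and y: "\<And>i. i \<le> n \<Longrightarrow> y i \<in> A"
  shows "x \<otimes> big_join_on A (\<sqsubseteq>) (map y [0..<Suc n]) = big_join_on A (\<sqsubseteq>)
      (map (\<lambda>j. x \<otimes> big_join_on A (\<sqsubseteq>) (map y (filter (\<lambda>i. i \<noteq> j) [0..<Suc n]))) [0..<Suc n])
    \<longleftrightarrow> x \<otimes> Join (y ` {..n}) = Join ((\<lambda>j. x \<otimes> Join (y ` ({..n} - {j}))) ` {..n})"
proof -
  have set_upt: "set [0..<Suc n] = {..n}" by auto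
  have YjA: "Join (y ` ({..n} - {j})) \<in> A" for j
    by (rule JOIN_closed) (use y n others_nonempty in auto)
  have others: "big_join_on A (\<sqsubseteq>) (map y (filter (\<lambda>i. i \<noteq> j) [0..<Suc n])) = Join (y ` ({..n} - {j}))" for j
  proof -
    have s: "set (filter (\<lambda>i. i \<noteq> j) [0..<Suc n]) = {..n} - {j}" by auto
    then have "filter (\<lambda>i. i \<noteq> j) [0..<Suc n] \<noteq> []"
      using others_nonempty[OF n, of j] by (metis set_empty)
    then show ?thesis using y s by (subst big_join_map) auto
  qed
  have "big_join_on A (\<sqsubseteq>) (map y [0..<Suc n]) = Join (y ` {..n})"
    using y set_upt by (subst big_join_map) auto
  moreover have "big_join_on A (\<sqsubseteq>) (map (\<lambda>j. x \<otimes> Join (y ` ({..n} - {j}))) [0..<Suc n]) =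
      Join ((\<lambda>j. x \<otimes> Join (y ` ({..n} - {j}))) ` {..n})"
    using x YjA set_upt by (subst big_join_map) auto
  ultimately show ?thesis unfolding others by simp
qed

end

context local_modular_lattice
begin

text \<open>The element \<open>p\<close> is join irreducible above \<open>d\<close>, with \<open>m\<close> its only lower cover.\<close>
lemma atom_exchange:
  assumes n: "n \<ge> 1" and nd: "n_distributive_above n q" and q: "cover d q"
    and p: "p \<in> A" and m: "m \<in> A" "d \<sqsubseteq> m" "m \<sqsubseteq> p" "m \<noteq> p"
    and m_max: "\<And>e. e \<in> A \<Longrightarrow> d \<sqsubseteq> e \<Longrightarrow> e \<sqsubseteq> p \<Longrightarrow> e \<noteq> p \<Longrightarrow> e \<sqsubseteq> m"
    and "q \<noteq> p" and y: "minimally_spanned n d p y"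
  shows "\<exists>j\<le>n. p \<sqsubseteq> q \<oplus> Join (y ` ({..n} - {j}))"
proof (rule ccontr)
  assume none: "\<not> ?thesis"
  let ?Y = "\<lambda>j. Join (y ` ({..n} - {j}))"
  \<comment> \<open>The identity above \<open>q\<close> will be applied with
    \<open>x = q \<oplus> p\<close> to these elements, which are raised above
    \<open>q\<close>.\<close>
  let ?y = "\<lambda>i. q \<oplus> y i"
  note qA = coverD[OF q]
  have yA: "i \<le> n \<Longrightarrow> y i \<in> A" for i
    using y by (auto simp: minimally_spanned_def)
  have pY: "p \<sqsubseteq> Join (y ` {..n})"
    using y by (auto simp: minimally_spanned_def)
  have YA: "Join (y ` {..n}) \<in> A" by (rule JOIN_closed) (use yA in auto)
  have YjA: "?Y j \<in> A" for j by (rule JOIN_closed) (use yA n others_nonempty in auto)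
  have y'A: "i \<le> n \<Longrightarrow> ?y i \<in> A" for i using qA yA by simp
  have Y'A: "Join (?y ` {..n}) \<in> A" by (rule JOIN_closed) (use y'A in auto)
  have Y'jA: "Join (?y ` ({..n} - {j})) \<in> A" for j
    by (rule JOIN_closed) (use y'A n others_nonempty in auto)
  have dp: "d \<sqsubseteq> p" using trans[of d m p] m p qA by blast
  have Y'j: "Join (?y ` ({..n} - {j})) \<sqsubseteq> q \<oplus> ?Y j" for j
  proof (rule JOIN_least)
    fix i assume i: "i \<in> {..n} - {j}"
    have "y i \<sqsubseteq> ?Y j" by (rule JOIN_upper) (use i yA in auto)
    then show "?y i \<sqsubseteq> q \<oplus> ?Y j" using i yA YjA qA by (intro join_mono) auto
  qed (use y'A qA YjA n others_nonempty in auto)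
  have Y': "q \<oplus> p \<sqsubseteq> Join (?y ` {..n})"
  proof (rule join_least)
    show "q \<sqsubseteq> Join (?y ` {..n})"
      by (rule JOIN_le_trans[of _ _ 0]) (use qA yA in auto)
    have "Join (y ` {..n}) \<sqsubseteq> Join (?y ` {..n})"
      by (rule JOIN_mono) (use qA yA in auto)
    then show "p \<sqsubseteq> Join (?y ` {..n})" using trans[OF pY] p YA Y'A by blast
  qed (use p qA Y'A in auto)
  \<comment> \<open>By modularity the summand is below \<open>q \<oplus> ?e\<close>. The assumption
    \<open>none\<close> makes \<open>?e\<close> differ from \<open>p\<close>, and then
    \<open>?e\<close> is below \<open>m\<close>.\<close>
  have summand: "(q \<oplus> p) \<otimes> Join (?y ` ({..n} - {j})) \<sqsubseteq> q \<oplus> m" if "j \<le> n" for j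
  proof -
    let ?e = "p \<otimes> (q \<oplus> ?Y j)"
    have eA: "?e \<in> A" "?e \<sqsubseteq> p" using p qA YjA by auto
    have "?e \<noteq> p" using none that p qA YjA by (metis join_closed meet_le2)
    moreover have "d \<sqsubseteq> ?e"
      using dp p qA YjA trans[of d q "q \<oplus> ?Y j"] by (intro meet_greatest) auto
    ultimately have "?e \<sqsubseteq> m" using m_max eA by blast
    then have "q \<oplus> ?e \<sqsubseteq> q \<oplus> m" using qA eA m by (intro join_mono) auto
    moreover have "q \<oplus> ?e = (q \<oplus> p) \<otimes> (q \<oplus> ?Y j)"
      using p qA YjA by (intro modular) auto
    moreover have "(q \<oplus> p) \<otimes> Join (?y ` ({..n} - {j})) \<sqsubseteq> (q \<oplus> p) \<otimes> (q \<oplus> ?Y j)"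
      using p qA YjA Y'jA trans[OF meet_le2 Y'j[of j], of "q \<oplus> p"] by (intro meet_greatest) auto
    ultimately show ?thesis
      using trans[of "(q \<oplus> p) \<otimes> Join (?y ` ({..n} - {j}))" "q \<oplus> ?e" "q \<oplus> m"] p qA YjA Y'jA m
      by simp
  qed
  have "(q \<oplus> p) \<otimes> Join (?y ` {..n}) \<sqsubseteq>
      Join ((\<lambda>j. (q \<oplus> p) \<otimes> Join (?y ` ({..n} - {j}))) ` {..n})" (is "_ \<sqsubseteq> ?r")
    using nd p qA yA unfolding n_distributive_above_def by (simp add: y'A)
  moreover have "?r \<sqsubseteq> q \<oplus> m"
    by (rule JOIN_least) (use summand p qA Y'jA m in auto)
  moreover have "(q \<oplus> p) \<otimes> Join (?y ` {..n}) = q \<oplus> p"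
    using Y' p qA Y'A by (intro meet_absorb) auto
  moreover have "?r \<in> A" by (rule JOIN_closed) (use p qA Y'jA in auto)
  ultimately have "q \<oplus> p \<sqsubseteq> q \<oplus> m" using trans[of "q \<oplus> p" ?r "q \<oplus> m"] p qA m by simp
  \<comment> \<open>Modularity now gives \<open>p = m \<oplus> q \<otimes> p\<close>. Since
    \<open>q \<otimes> p\<close> is not \<open>p\<close>, it is below \<open>m\<close>, which forces
    \<open>p = m\<close>.\<close>
  then have "p \<sqsubseteq> m \<oplus> q"
    using trans[of p "q \<oplus> p" "q \<oplus> m"] p qA m join_commute by simp
  then have "(m \<oplus> q) \<otimes> p = p"
    using meet_absorb[of p "m \<oplus> q"] meet_commute[of p "m \<oplus> q"] p qA m by simp
  then have "m \<oplus> q \<otimes> p = p" using modular[of m q p] p qA m by simp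
  moreover have "q \<otimes> p \<sqsubseteq> m"
  proof (rule m_max)
    show "d \<sqsubseteq> q \<otimes> p" using dp p qA by (intro meet_greatest) auto
    show "q \<otimes> p \<noteq> p"
    proof
      assume "q \<otimes> p = p"
      then have "p \<sqsubseteq> q" using p qA by (metis meet_le1)
      then have "p = d" using qA(5)[OF p dp] \<open>q \<noteq> p\<close> by blast
      then show False using m p antisym[of m p] by blast
    qed
  qed (use p qA in auto)
  then have "m \<oplus> q \<otimes> p = m"
    using join_absorb[of "q \<otimes> p" m] join_commute[of m "q \<otimes> p"] p qA m by simp
  ultimately show False using m by simp
qed

text \<open>The entries are replaced one at a time, \<open>k\<close> counting those already
  replaced. Shrinking an entry keeps \<open>p\<close> out of the partial joins;
  \<open>atom_exchange\<close> keeps it below the full join.\<close>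

lemma spanned_by_atoms:
  assumes n: "n \<ge> 1" and nd: "\<And>q. cover d q \<Longrightarrow> n_distributive_above n q"
    and p: "cover d p" and y: "minimally_spanned n d p y"
  shows "\<exists>z. minimally_spanned n d p z \<and> (\<forall>i\<le>n. cover d (z i))"
proof -
  note pA = coverD[OF p]
  have "\<exists>z. minimally_spanned n d p z \<and> (\<forall>i<k. cover d (z i))" if "k \<le> Suc n" for k
    using that
  proof (induction k)
    case 0
    then show ?case using y by blast
  next
    case (Suc k)
    then have k: "k \<le> n" by simp
    obtain z where z: "minimally_spanned n d p z" and at: "\<And>i. i < k \<Longrightarrow> cover d (z i)"
      using Suc by auto
    let ?Z = "\<lambda>j. Join (z ` ({..n} - {j}))"
    have zA: "i \<le> n \<Longrightarrow> z i \<in> A" and dz: "i \<le> n \<Longrightarrow> d \<sqsubseteq> z i" for i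
      using z by (auto simp: minimally_spanned_def)
    have pZ: "p \<sqsubseteq> Join (z ` {..n})"
      using z by (auto simp: minimally_spanned_def)
    have npZ: "j \<le> n \<Longrightarrow> \<not> p \<sqsubseteq> ?Z j" for j
      using z by (auto simp: minimally_spanned_def)
    have ZA: "Join (z ` {..n}) \<in> A" by (rule JOIN_closed) (use zA in auto)
    have ZjA: "?Z j \<in> A" for j by (rule JOIN_closed) (use zA n others_nonempty in auto)
    have z_le: "z i \<sqsubseteq> ?Z j" if "i \<le> n" "i \<noteq> j" for i j
      by (rule JOIN_upper) (use that zA in auto)
    obtain l where l: "l \<le> n" "l \<noteq> k"
      using others_nonempty[OF n, of k] by blast
    \<comment> \<open>An entry equal to \<open>d\<close> is below the entry at \<open>l\<close>, so
      it could be dropped from the full join, against irredundancy at \<open>k\<close>.\<close>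
    have "z k \<noteq> d"
    proof
      assume eq: "z k = d"
      have "Join (z ` {..n}) \<sqsubseteq> ?Z k"
      proof (rule JOIN_least)
        fix i assume i: "i \<in> {..n}"
        show "z i \<sqsubseteq> ?Z k"
          using z_le[of i k] trans[OF dz[OF l(1)] z_le[OF l]] i pA zA l ZjA eq by (cases "i = k") auto
      qed (use zA ZjA in auto)
      then show False using npZ[OF k] trans[OF pZ] pA ZA ZjA by blast
    qed
    then obtain q where q: "cover d q" "q \<sqsubseteq> z k"
      using ex_cover[OF dcc pA(1) zA[OF k] dz[OF k]] by metis
    note qA = coverD[OF q(1)]
    have q_le: "q \<sqsubseteq> ?Z j" if "j \<noteq> k" for j
      using trans[OF q(2) z_le[OF k]] that qA zA[OF k] ZjA by metis
    have "q \<noteq> p" using q_le[OF l(2)] npZ[OF l(1)] by blast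
    \<comment> \<open>As \<open>p\<close> covers \<open>d\<close>, the element \<open>d\<close>
      itself serves as the lower cover \<open>m\<close> of \<open>p\<close> in
      \<open>atom_exchange\<close>.\<close>
    obtain j where j: "j \<le> n" "p \<sqsubseteq> q \<oplus> ?Z j"
      using atom_exchange[OF n nd[OF q(1)] q(1) pA(2) pA(1) refl[OF pA(1)] pA(3,4) _ \<open>q \<noteq> p\<close> z]
        pA(5) pA(1) refl by metis
    \<comment> \<open>For \<open>j \<noteq> k\<close> the entry \<open>z k\<close> still belongs to
      the partial join, so \<open>q\<close> adds nothing and \<open>p\<close> would already be below
      \<open>?Z j\<close>.\<close>
    have "j = k"
    proof (rule ccontr)
      assume "j \<noteq> k"
      then have "q \<oplus> ?Z j = ?Z j" using q_le qA ZjA by (intro join_absorb) auto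
      then show False using j npZ by simp
    qed
    let ?z = "z(k := q)"
    have z'A: "i \<le> n \<Longrightarrow> ?z i \<in> A" for i using zA qA by simp
    have img: "?z ` ({..n} - {k}) = z ` ({..n} - {k})" by auto
    have Z'A: "Join (?z ` {..n}) \<in> A" by (rule JOIN_closed) (use z'A in auto)
    have Z'jA: "Join (?z ` ({..n} - {j})) \<in> A" for j
      by (rule JOIN_closed) (use z'A n others_nonempty in auto)
    have "q \<oplus> ?Z k \<sqsubseteq> Join (?z ` {..n})"
    proof (rule join_least)
      show "q \<sqsubseteq> Join (?z ` {..n})"
        by (rule JOIN_le_trans[of _ _ k]) (use z'A k qA in auto)
      show "?Z k \<sqsubseteq> Join (?z ` {..n})"
      proof (rule JOIN_least)
        fix i assume "i \<in> {..n} - {k}"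
        then show "z i \<sqsubseteq> Join (?z ` {..n})"
          by (intro JOIN_le_trans[of _ _ i] z'A) (use zA in auto)
      qed (use zA Z'A n others_nonempty in auto)
    qed (use qA ZjA Z'A in auto)
    then have "p \<sqsubseteq> Join (?z ` {..n})"
      using trans[OF j(2)] \<open>j = k\<close> pA qA ZjA Z'A by simp
    moreover have "\<not> p \<sqsubseteq> Join (?z ` ({..n} - {i}))" if "i \<le> n" for i
    proof
      assume p': "p \<sqsubseteq> Join (?z ` ({..n} - {i}))"
      have "Join (?z ` ({..n} - {i})) \<sqsubseteq> ?Z i"
        by (rule JOIN_mono) (use z'A zA q n others_nonempty in auto)
      then show False using npZ[OF that] trans[OF p'] pA ZjA Z'jA by blast
    qed
    ultimately have "minimally_spanned n d p ?z"
      using z'A dz qA by (simp add: minimally_spanned_def)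
    moreover have "\<forall>i<Suc k. cover d (?z i)" using at q by (simp add: less_Suc_eq)
    ultimately show ?case by blast
  qed
  then show ?thesis by (metis le_refl less_Suc_eq_le)
qed

text \<open>\<open>atoms\<close> concerns only elements covering a common \<open>d\<close>.
  Induction from the top supplies the identity above every cover of \<open>d\<close>; a failure
  above \<open>d\<close> is then shrunk to a configuration that \<open>atoms\<close>
  excludes.\<close>

lemma n_distributive_above:
  assumes n: "n \<ge> 1"
    and atoms: "\<And>d p y. cover d p \<Longrightarrow> \<forall>i\<le>n. cover d (y i) \<Longrightarrow> \<not> minimally_spanned n d p y"
    and "d \<in> A"
  shows "n_distributive_above n d"
  using \<open>d \<in> A\<close>
proof (induction d rule: wfp_induct_rule[OF acc])
  case (1 d)
  have nd: "n_distributive_above n q" if "cover d q" for q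
    using 1(1)[of q] coverD[OF that] by (simp add: strict_on_def)
  show ?case
    unfolding n_distributive_above_def
  proof (intro ballI allI impI, rule ccontr)
    fix x y
    assume x: "x \<in> A" "d \<sqsubseteq> x" and y: "\<forall>i\<le>n. y i \<in> A \<and> d \<sqsubseteq> y i"
    let ?Y = "\<lambda>j. Join (y ` ({..n} - {j}))"
    let ?l = "x \<otimes> Join (y ` {..n})" and ?r = "Join ((\<lambda>j. x \<otimes> ?Y j) ` {..n})"
    assume "\<not> ?l \<sqsubseteq> ?r"
    have YA: "Join (y ` {..n}) \<in> A" by (rule JOIN_closed) (use y in auto)
    have YjA: "?Y j \<in> A" for j by (rule JOIN_closed) (use y n others_nonempty in auto)
    have rA: "?r \<in> A" by (rule JOIN_closed) (use x YjA in auto)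
    have dY: "d \<sqsubseteq> Join (y ` {..n})"
      by (rule JOIN_le_trans[of _ _ 0]) (use y 1 in auto)
    have dYj: "d \<sqsubseteq> ?Y j" for j
    proof -
      obtain i where i: "i \<in> {..n} - {j}" using others_nonempty[OF n, of j] by blast
      show ?thesis by (rule JOIN_le_trans[OF _ _ i]) (use i y 1 in auto)
    qed
    have xYj: "x \<otimes> ?Y j \<sqsubseteq> ?r" if "j \<le> n" for j
      by (rule JOIN_upper[of _ "\<lambda>j. x \<otimes> ?Y j"]) (use that x YjA in auto)
    have lA: "?l \<in> A" "d \<sqsubseteq> ?l" using x dY YA 1 by (auto intro: meet_greatest)
    have dr: "d \<sqsubseteq> ?r"
      using trans[OF meet_greatest[OF x(2) dYj[of 0]] xYj[of 0]] x YjA rA 1 by simp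
    \<comment> \<open>For a minimal \<open>p\<close> in \<open>?Q\<close>, every element of the
      interval from \<open>d\<close> to \<open>p\<close> other than \<open>p\<close> is below
      \<open>?r\<close>. Hence \<open>p \<otimes> ?r\<close> is the only lower cover of
      \<open>p\<close> above \<open>d\<close>.\<close>
    let ?Q = "{p \<in> A. d \<sqsubseteq> p \<and> p \<sqsubseteq> ?l \<and> \<not> p \<sqsubseteq> ?r}"
    have "?l \<in> ?Q" using lA \<open>\<not> ?l \<sqsubseteq> ?r\<close> by simp
    then obtain p where p: "p \<in> ?Q" and min: "\<And>e. strict_on A (\<sqsubseteq>) e p \<Longrightarrow> e \<notin> ?Q"
      using dcc unfolding wfp_eq_minimal by (metis (no_types, lifting))
    then have pA: "p \<in> A" "d \<sqsubseteq> p" "p \<sqsubseteq> ?l" "\<not> p \<sqsubseteq> ?r" by auto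
    have below: "e \<sqsubseteq> ?r" if "e \<in> A" "d \<sqsubseteq> e" "e \<sqsubseteq> p" "e \<noteq> p" for e
      using min[of e] that pA trans[of e p ?l] lA by (auto simp: strict_on_def)
    have px: "p \<sqsubseteq> x" "p \<sqsubseteq> Join (y ` {..n})"
      using trans[OF pA(3)] pA lA x YA by auto
    have span: "minimally_spanned n d p y"
    proof -
      have "\<not> p \<sqsubseteq> ?Y j" if "j \<le> n" for j
        using trans[OF meet_greatest[OF px(1)] xYj[OF that]] pA x YjA rA by auto
      then show ?thesis using px y by (simp add: minimally_spanned_def)
    qed
    let ?m = "p \<otimes> ?r"
    have m: "?m \<in> A" "d \<sqsubseteq> ?m" "?m \<sqsubseteq> p"
      using pA rA dr 1 by (auto intro: meet_greatest)
    have "?m \<noteq> p" using pA rA by (metis meet_le2)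
    have m_max: "e \<sqsubseteq> ?m" if "e \<in> A" "d \<sqsubseteq> e" "e \<sqsubseteq> p" "e \<noteq> p" for e
      using below[OF that] that pA rA by (intro meet_greatest) auto
    have "p \<noteq> d" using pA dr by blast
    then obtain q where q: "cover d q" "q \<sqsubseteq> p"
      using ex_cover[OF dcc \<open>d \<in> A\<close> pA(1,2)] by metis
    note qA = coverD[OF q(1)]
    \<comment> \<open>Otherwise the exchange and modularity give
      \<open>p = q \<oplus> ?Y j \<otimes> p\<close>, where both parts differ from \<open>p\<close>
      and so lie below \<open>?m\<close>.\<close>
    have "q = p"
    proof (rule ccontr)
      assume "q \<noteq> p"
      then obtain j where j: "j \<le> n" "p \<sqsubseteq> q \<oplus> ?Y j"
        using atom_exchange[OF n nd[OF q(1)] q(1) pA(1) m \<open>?m \<noteq> p\<close> m_max _ span] by blast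
      have "p \<otimes> ?Y j \<sqsubseteq> ?m"
      proof (rule m_max)
        show "p \<otimes> ?Y j \<noteq> p"
          using span j pA YjA meet_le2[of p "?Y j"] by (auto simp: minimally_spanned_def simp del: meet_le2)
      qed (use pA YjA dYj 1 in \<open>auto intro: meet_greatest\<close>)
      moreover have "q \<sqsubseteq> ?m" using m_max q qA \<open>q \<noteq> p\<close> by blast
      ultimately have "q \<oplus> ?Y j \<otimes> p \<sqsubseteq> ?m"
        using qA pA YjA m meet_commute[of p "?Y j"] by (intro join_least) auto
      moreover have "q \<oplus> ?Y j \<otimes> p = (q \<oplus> ?Y j) \<otimes> p"
        using qA pA YjA q by (intro modular) auto
      moreover have "(q \<oplus> ?Y j) \<otimes> p = p"
        using meet_absorb[OF j(2)] meet_commute[of p "q \<oplus> ?Y j"] pA qA YjA by simp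
      ultimately show False using antisym[of p ?m] m pA \<open>?m \<noteq> p\<close> by simp
    qed
    then show False
      using spanned_by_atoms[OF n nd _ span] q(1) atoms by blast
  qed
qed

lemma n_distributive_onI:
  assumes n: "n \<ge> 1"
    and atoms: "\<And>d p y. cover d p \<Longrightarrow> \<forall>i\<le>n. cover d (y i) \<Longrightarrow> \<not> minimally_spanned n d p y"
  shows "n_distributive_on A (\<sqsubseteq>) n"
  unfolding n_distributive_on_def
proof (intro conjI ballI allI impI)
  fix x y
  assume x: "x \<in> A" and y: "\<forall>i\<le>n. y i \<in> A"
  let ?Y = "\<lambda>j. Join (y ` ({..n} - {j}))"
  let ?l = "x \<otimes> Join (y ` {..n})" and ?r = "Join ((\<lambda>j. x \<otimes> ?Y j) ` {..n})"
  have YA: "Join (y ` {..n}) \<in> A" by (rule JOIN_closed) (use y in auto)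
  have YjA: "?Y j \<in> A" for j by (rule JOIN_closed) (use y n others_nonempty in auto)
  \<comment> \<open>Above the least element the restricted inequality becomes the unrestricted one;
    the converse inequality holds in every lattice.\<close>
  obtain d where d: "d \<in> A" "\<And>a. a \<in> A \<Longrightarrow> d \<sqsubseteq> a"
    using ex_least[OF dcc] x by blast
  have "?l = ?r"
  proof (rule antisym)
    show "?l \<sqsubseteq> ?r"
      using n_distributive_above[OF n atoms d(1)] x y d by (simp add: n_distributive_above_def)
    show "?r \<sqsubseteq> ?l"
    proof (rule JOIN_least)
      fix j assume "j \<in> {..n}"
      have "?Y j \<sqsubseteq> Join (y ` {..n})"
      proof (rule JOIN_least)
        fix i assume "i \<in> {..n} - {j}"
        then show "y i \<sqsubseteq> Join (y ` {..n})" by (intro JOIN_upper) (use y in auto)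
      qed (use y YA n others_nonempty in auto)
      then show "x \<otimes> ?Y j \<sqsubseteq> ?l"
        using x YA YjA trans[of "x \<otimes> ?Y j" "?Y j" "Join (y ` {..n})"] by (intro meet_greatest) auto
    qed (use x YA YjA in auto)
    show "?r \<in> A" by (rule JOIN_closed) (use x YjA in auto)
  qed (use x YA in auto)
  then show "x \<otimes> big_join_on A (\<sqsubseteq>) (map y [0..<Suc n]) = big_join_on A (\<sqsubseteq>)
      (map (\<lambda>j. x \<otimes> big_join_on A (\<sqsubseteq>) (map y (filter (\<lambda>i. i \<noteq> j) [0..<Suc n]))) [0..<Suc n])"
    using n_distributive_identity[OF n x] y by simp
qed (fact lattice modular_on)+

end

section \<open>Glued sums\<close>

text \<open>The index lattice is a parameter of the locale and not a type class instance, so that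
  the index order and all blocks can be reversed together. Filters and ideals are spelled out
  elementwise for the same purpose.\<close>

locale glued = lattice inf less_eq less sup
  for inf :: "'s \<Rightarrow> 's \<Rightarrow> 's" (infixl "\<sqinter>" 70)
    and less_eq :: "'s \<Rightarrow> 's \<Rightarrow> bool" (infix "\<preceq>" 50)
    and less :: "'s \<Rightarrow> 's \<Rightarrow> bool" (infix "\<prec>" 50)
    and sup :: "'s \<Rightarrow> 's \<Rightarrow> 's" (infixl "\<squnion>" 65) +
  fixes C :: "'s \<Rightarrow> 'a set" and R :: "'s \<Rightarrow> 'a \<Rightarrow> 'a \<Rightarrow> bool"
  assumes index_finite: "finite_length_on UNIV (\<preceq>)"
    and block_lattice: "lattice_on (C x) (R x)"
    and block_finite: "finite_length_on (C x) (R x)"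
    and filter_up: "\<lbrakk>x \<preceq> y; a \<in> C x; a \<in> C y; b \<in> C x; R x a b\<rbrakk> \<Longrightarrow> b \<in> C y"
    and ideal_down: "\<lbrakk>x \<preceq> y; a \<in> C x; a \<in> C y; b \<in> C y; R y b a\<rbrakk> \<Longrightarrow> b \<in> C x"
    and filter_meet: "\<lbrakk>x \<preceq> y; a \<in> C x; a \<in> C y; b \<in> C x; b \<in> C y\<rbrakk> \<Longrightarrow> meet_on (C x) (R x) a b \<in> C y"
    and ideal_join: "\<lbrakk>x \<preceq> y; a \<in> C x; a \<in> C y; b \<in> C x; b \<in> C y\<rbrakk> \<Longrightarrow> join_on (C y) (R y) a b \<in> C x"
    and orders_agree: "\<lbrakk>x \<preceq> y; a \<in> C x; a \<in> C y; b \<in> C x; b \<in> C y\<rbrakk> \<Longrightarrow> R x a b \<longleftrightarrow> R y a b"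
    and adjacent: "\<lbrakk>x \<prec> y; \<And>z. x \<prec> z \<Longrightarrow> \<not> z \<prec> y\<rbrakk> \<Longrightarrow> C x \<inter> C y \<noteq> {}"
    and overlap_inf: "\<lbrakk>a \<in> C x; a \<in> C y\<rbrakk> \<Longrightarrow> a \<in> C (x \<sqinter> y)"
    and overlap_sup: "\<lbrakk>a \<in> C x; a \<in> C y\<rbrakk> \<Longrightarrow> a \<in> C (x \<squnion> y)"
begin

lemma dual: "glued (\<squnion>) (\<lambda>x y. y \<preceq> x) (\<lambda>x y. y \<prec> x) (\<sqinter>) C (\<lambda>x a b. R x b a)"
proof (intro glued.intro glued_axioms.intro)
  show "class.lattice (\<squnion>) (\<lambda>x y. y \<preceq> x) (\<lambda>x y. y \<prec> x) (\<sqinter>)" by (rule dual_lattice)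
  show "finite_length_on UNIV (\<lambda>x y. y \<preceq> x)" by (rule finite_length_on_dual[OF index_finite])
  show "lattice_on (C x) (\<lambda>a b. R x b a)" for x by (rule lattice_on_dual[OF block_lattice])
  show "finite_length_on (C x) (\<lambda>a b. R x b a)" for x
    by (rule finite_length_on_dual[OF block_finite])
  show "C x \<inter> C y \<noteq> {}" if "y \<prec> x" "\<And>z. z \<prec> x \<Longrightarrow> \<not> y \<prec> z" for x y
    using adjacent[of y x] that by blast
  show "y \<preceq> x \<Longrightarrow> a \<in> C x \<Longrightarrow> a \<in> C y \<Longrightarrow> b \<in> C x \<Longrightarrow> R x b a \<Longrightarrow> b \<in> C y" for x y a b
    using ideal_down by blast
  show "y \<preceq> x \<Longrightarrow> a \<in> C x \<Longrightarrow> a \<in> C y \<Longrightarrow> b \<in> C y \<Longrightarrow> R y a b \<Longrightarrow> b \<in> C x" for x y a b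
    using filter_up by blast
  show "y \<preceq> x \<Longrightarrow> a \<in> C x \<Longrightarrow> a \<in> C y \<Longrightarrow> b \<in> C x \<Longrightarrow> b \<in> C y \<Longrightarrow>
      meet_on (C x) (\<lambda>a b. R x b a) a b \<in> C y" for x y a b
    using ideal_join unfolding meet_on_dual[of "C x" "R x"] by blast
  show "y \<preceq> x \<Longrightarrow> a \<in> C x \<Longrightarrow> a \<in> C y \<Longrightarrow> b \<in> C x \<Longrightarrow> b \<in> C y \<Longrightarrow>
      join_on (C y) (\<lambda>a b. R y b a) a b \<in> C x" for x y a b
    using filter_meet unfolding join_on_dual[of "C y" "R y"] by blast
  show "y \<preceq> x \<Longrightarrow> a \<in> C x \<Longrightarrow> a \<in> C y \<Longrightarrow> b \<in> C x \<Longrightarrow> b \<in> C y \<Longrightarrow> R x b a = R y b a" for x y a b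
    using orders_agree[of y x b a] by blast
  show "a \<in> C x \<Longrightarrow> a \<in> C y \<Longrightarrow> a \<in> C (x \<squnion> y)" for x y a by (rule overlap_sup)
  show "a \<in> C x \<Longrightarrow> a \<in> C y \<Longrightarrow> a \<in> C (x \<sqinter> y)" for x y a by (rule overlap_inf)
qed

sublocale block: carrier_lattice "C x" "R x" for x
  by unfold_locales (rule block_lattice)

sublocale index: carrier_lattice UNIV "(\<preceq>)"
proof
  have "is_lub_on UNIV (\<preceq>) x y (x \<squnion> y)" "is_glb_on UNIV (\<preceq>) x y (x \<sqinter> y)" for x y
    by (auto simp: is_lub_on_def is_glb_on_def)
  moreover have "partial_order_on' UNIV (\<preceq>)"
    unfolding partial_order_on'_def using order_trans order.antisym by auto
  ultimately show "lattice_on UNIV (\<preceq>)" unfolding lattice_on_def by blast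
qed

lemma index_dcc: "wfp (strict_on UNIV (\<preceq>))"
  by (rule finite_length_on_wfp[OF index.po index_finite])

lemma index_acc: "wfp (strict_on UNIV (\<lambda>x y. y \<preceq> x))"
  using glued.index_dcc[OF dual] .

lemma block_dcc: "wfp (strict_on (C x) (R x))"
  by (rule finite_length_on_wfp[OF block.po block_finite])

lemma block_acc: "wfp (strict_on (C x) (\<lambda>a b. R x b a))"
  using glued.block_dcc[OF dual] .

text \<open>Only neighbouring indices are known to have overlapping blocks. A cover of
  \<open>x\<close> below \<open>y\<close> allows \<open>y\<close> to be reached step by step through
  overlapping blocks.\<close>

lemma index_step:
  assumes "x \<prec> y"
  obtains x' where "x \<prec> x'" "x' \<preceq> y" "C x \<inter> C x' \<noteq> {}"
proof -
  obtain x' where x': "index.cover x x'" "x' \<preceq> y"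
    using index.ex_cover[OF index_dcc, of x y] assms by (auto simp: less_le)
  note c = index.coverD[OF x'(1)]
  have "x \<prec> x'" using c by (simp add: less_le)
  moreover have "C x \<inter> C x' \<noteq> {}"
    using adjacent[OF \<open>x \<prec> x'\<close>] c(5) by (metis UNIV_I less_le)
  ultimately show thesis using that x' by blast
qed

lemma index_induct [case_names less]:
  assumes "\<And>x. (\<And>y. x \<prec> y \<Longrightarrow> P y) \<Longrightarrow> P x"
  shows "P x"
  by (induction x rule: wfp_induct_rule[OF index_acc])
    (rule assms, auto simp: strict_on_def less_le)

lemma index_maximal:
  assumes "P x"
  shows "\<exists>m. P m \<and> (\<forall>y. m \<prec> y \<longrightarrow> \<not> P y)"
  using assms by (induction x rule: index_induct) blast

text \<open>This is the \<open>0_x\<close> of the block. \<open>lattice_on\<close> admits an empty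
  carrier, hence the guard \<open>C x \<noteq> {}\<close> in the facts about it.\<close>

definition bot :: "'s \<Rightarrow> 'a" where
  "bot x = (SOME z. z \<in> C x \<and> (\<forall>a\<in>C x. R x z a))"

lemma
  assumes "C x \<noteq> {}"
  shows bot_closed: "bot x \<in> C x" and bot_least: "\<And>a. a \<in> C x \<Longrightarrow> R x (bot x) a"
proof -
  have "\<exists>z. z \<in> C x \<and> (\<forall>a\<in>C x. R x z a)"
    using block.ex_least[OF block_dcc assms] by metis
  then have "bot x \<in> C x \<and> (\<forall>a\<in>C x. R x (bot x) a)"
    unfolding bot_def by (rule someI_ex)
  then show "bot x \<in> C x" "\<And>a. a \<in> C x \<Longrightarrow> R x (bot x) a" by auto
qed

lemma ex_top:
  assumes "C x \<noteq> {}"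
  obtains t where "t \<in> C x" "\<And>a. a \<in> C x \<Longrightarrow> R x a t"
  using glued.bot_closed[OF dual assms] glued.bot_least[OF dual assms] by blast

text \<open>Climb from \<open>x\<close> to \<open>y\<close>. The greatest element \<open>t\<close>
  of \<open>C x\<close> lies in the next block \<open>C x'\<close> and in \<open>C z\<close> by the
  filter property; \<open>a\<close> is below \<open>t\<close> in \<open>C z\<close>, so the ideal
  property puts \<open>a\<close> into \<open>C x'\<close>.\<close>

lemma block_between:
  assumes "x \<preceq> y" "y \<preceq> z" "a \<in> C x" "a \<in> C z"
  shows "a \<in> C y"
  using assms
proof (induction x rule: index_induct)
  case (less x)
  show ?case
  proof (cases "x = y")
    case False
    then have "x \<prec> y" using less by (simp add: less_le)
    then obtain x' where x': "x \<prec> x'" "x' \<preceq> y" "C x \<inter> C x' \<noteq> {}" by (rule index_step)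
    obtain t where t: "t \<in> C x" "\<And>a. a \<in> C x \<Longrightarrow> R x a t"
      using ex_top[of x] less by blast
    have le: "x \<preceq> x'" "x' \<preceq> z" "x \<preceq> z"
      using x' less by (auto intro: order_trans)
    obtain e where "e \<in> C x" "e \<in> C x'" using x' by blast
    then have "t \<in> C x'" using filter_up[OF le(1)] t by blast
    moreover have "t \<in> C z" using filter_up[OF le(3) less(4,5)] t less by blast
    moreover have "R z a t" using orders_agree[OF le(3) less(4,5)] t less \<open>t \<in> C z\<close> by blast
    ultimately have "a \<in> C x'" using ideal_down[OF le(2)] less by blast
    then show ?thesis using less x' by blast
  qed (use less in simp)
qed

section \<open>The order of the glued sum and its restriction to blocks\<close>

abbreviation L :: "'a set" where "L \<equiv> glued_carrier C"
abbreviation le (infix "\<sqsubseteq>" 50) where "a \<sqsubseteq> b \<equiv> glued_le C R a b"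

lemma L_iff: "a \<in> L \<longleftrightarrow> (\<exists>x. a \<in> C x)"
  by (simp add: glued_carrier_def)

lemma le_dual: "glued_le C (\<lambda>x a b. R x b a) = (\<lambda>a b. b \<sqsubseteq> a)"
proof (intro ext)
  fix a b
  let ?r = "\<lambda>a b. \<exists>x. a \<in> C x \<and> b \<in> C x \<and> R x a b"
  have "(\<lambda>a b. \<exists>x. a \<in> C x \<and> b \<in> C x \<and> R x b a) = ?r\<inverse>\<inverse>"
    by (intro ext) auto
  then show "glued_le C (\<lambda>x a b. R x b a) a b = (b \<sqsubseteq> a)"
    unfolding glued_le_def by (simp add: tranclp_converse)
qed

lemma le_of_block: "a \<in> C x \<Longrightarrow> b \<in> C x \<Longrightarrow> R x a b \<Longrightarrow> a \<sqsubseteq> b"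
  unfolding glued_le_def by blast

lemma le_trans: "a \<sqsubseteq> b \<Longrightarrow> b \<sqsubseteq> c \<Longrightarrow> a \<sqsubseteq> c"
  unfolding glued_le_def by (rule tranclp_trans)

lemma le_refl: "a \<in> L \<Longrightarrow> a \<sqsubseteq> a"
  using le_of_block[of a _ a] by (auto simp: L_iff)

text \<open>Rerouting: a step inside \<open>C w\<close> starting in \<open>C y\<close> can be made
  inside the block of \<open>y \<squnion> w\<close>, by \<open>overlap_sup\<close> and the filter
  property. The last conjunct, carried along the same induction, shows that the sum adds no
  relations within a block.\<close>

lemma le_obtains_index:
  assumes "a \<sqsubseteq> b" "a \<in> C x"
  shows "\<exists>y. x \<preceq> y \<and> b \<in> C y \<and> (b \<in> C x \<longrightarrow> R x a b)"
  using assms(1) unfolding glued_le_def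
proof (induction rule: tranclp_induct)
  case (base b)
  then obtain w where w: "a \<in> C w" "b \<in> C w" "R w a b" by blast
  have up: "x \<preceq> x \<squnion> w" "w \<preceq> x \<squnion> w" by auto
  have a: "a \<in> C (x \<squnion> w)" using overlap_sup assms w by blast
  then have b: "b \<in> C (x \<squnion> w)" using filter_up[OF up(2)] w by blast
  then have "b \<in> C x \<longrightarrow> R x a b"
    using orders_agree[OF up(1)] orders_agree[OF up(2)] a w assms by blast
  then show ?case using b up by blast
next
  case (step b c)
  then obtain y where y: "x \<preceq> y" "b \<in> C y" "b \<in> C x \<longrightarrow> R x a b" by blast
  obtain w where w: "b \<in> C w" "c \<in> C w" "R w b c" using step by blast
  let ?z = "y \<squnion> w"
  have up: "y \<preceq> ?z" "w \<preceq> ?z" "x \<preceq> ?z" using y by (auto intro: order_trans)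
  have b: "b \<in> C ?z" using overlap_sup y w by blast
  then have c: "c \<in> C ?z" using filter_up[OF up(2)] w by blast
  have zbc: "R ?z b c" using orders_agree[OF up(2)] b c w by blast
  \<comment> \<open>If the chain returns to \<open>C x\<close>, then \<open>c\<close> also lies in
    the intermediate \<open>C y\<close>, and the ideal property brings \<open>b\<close> back into
    \<open>C x\<close>.\<close>
  have "R x a c" if "c \<in> C x"
  proof -
    have cy: "c \<in> C y" using block_between[OF y(1) up(1) that c] .
    then have "R y b c" using orders_agree[OF up(1)] y b c zbc by blast
    then have bx: "b \<in> C x" using ideal_down[OF y(1) that cy] y by blast
    then have "R x b c" using orders_agree[OF up(3)] b c that zbc by blast
    then show ?thesis using y(3) bx block.trans[of x a b c] assms that by blast
  qed
  then show ?case using up c by blast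
qed

lemma le_closed: "a \<sqsubseteq> b \<Longrightarrow> a \<in> L" "a \<sqsubseteq> b \<Longrightarrow> b \<in> L"
  unfolding glued_le_def L_iff by (induction rule: tranclp_induct) blast+

lemma block_le: "a \<in> C x \<Longrightarrow> b \<in> C x \<Longrightarrow> R x a b \<longleftrightarrow> a \<sqsubseteq> b"
  using le_obtains_index le_of_block by blast

text \<open>Reroute through \<open>y\<close>, containing \<open>b\<close>, and \<open>z\<close>,
  containing \<open>c\<close>. As \<open>c\<close> lies in \<open>C x\<close> and
  \<open>C z\<close>, it lies in \<open>C y\<close>, and the ideal property brings \<open>b\<close>
  down to \<open>C x\<close>.\<close>

lemma block_convex:
  assumes "a \<sqsubseteq> b" "b \<sqsubseteq> c" "a \<in> C x" "c \<in> C x"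
  shows "b \<in> C x"
proof -
  obtain y where y: "x \<preceq> y" "b \<in> C y" using le_obtains_index assms by blast
  obtain z where z: "y \<preceq> z" "c \<in> C z" "c \<in> C y \<longrightarrow> R y b c"
    using le_obtains_index[OF assms(2) y(2)] by blast
  have "c \<in> C y" using block_between y z assms by blast
  then show ?thesis using ideal_down[OF y(1) assms(4)] y z by blast
qed

lemma le_antisym:
  assumes "a \<sqsubseteq> b" "b \<sqsubseteq> a"
  shows "a = b"
proof -
  obtain x where "a \<in> C x" using le_closed(1)[OF assms(1)] L_iff by blast
  moreover from this have "b \<in> C x" using block_convex assms by blast
  ultimately show ?thesis using block.antisym[of x] block_le assms by blast
qed

text \<open>Least elements increase with the index: the least element of an overlapping higher block
  lies in the lower block by the ideal property.\<close>

lemma bot_mono: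
  assumes "x \<preceq> w" "u \<in> C w" "C x \<noteq> {}"
  shows "bot x \<sqsubseteq> u"
  using assms
proof (induction x rule: index_induct)
  case (less x)
  show ?case
  proof (cases "x = w")
    case True
    then show ?thesis using le_of_block bot_closed bot_least less by blast
  next
    case False
    then have "x \<prec> w" using less by (simp add: less_le)
    then obtain x' where x': "x \<prec> x'" "x' \<preceq> w" "C x \<inter> C x' \<noteq> {}" by (rule index_step)
    then obtain e where e: "e \<in> C x" "e \<in> C x'" by blast
    then have ne: "C x' \<noteq> {}" by blast
    then have "bot x' \<in> C x"
      using ideal_down[of x x' e "bot x'"] e x' bot_closed[OF ne] bot_least[OF ne] by auto
    then have "bot x \<sqsubseteq> bot x'"
      using le_of_block bot_closed bot_least less by blast
    then show ?thesis using less x' ne le_trans by blast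
  qed
qed

text \<open>\<open>c\<close> is the starting point of the first step out of \<open>C x\<close> on a
  chain to \<open>u\<close>. If that step is made in \<open>C w\<close>, then
  \<open>y = x \<squnion> w\<close> is strictly above \<open>x\<close>, since its block contains a
  point outside \<open>C x\<close>.\<close>

lemma leaving_block:
  assumes "a \<sqsubseteq> u" "a \<in> C x" "u \<notin> C x"
  shows "\<exists>y c. x \<prec> y \<and> c \<in> C x \<and> c \<in> C y \<and> R x a c \<and> c \<sqsubseteq> u"
proof -
  have new: "\<exists>y. x \<prec> y \<and> a \<in> C y" if "a \<in> C x" "a \<in> C w" "b \<in> C w" "R w a b" "b \<notin> C x" for a b w
  proof -
    have a: "a \<in> C (x \<squnion> w)" using overlap_sup that by blast
    then have "b \<in> C (x \<squnion> w)" using filter_up[OF sup_ge2 that(2) a that(3,4)] by simp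
    then have "x \<prec> x \<squnion> w" using that(5) by (metis less_le sup_ge1)
    then show ?thesis using a by blast
  qed
  show ?thesis
    using assms unfolding glued_le_def
  proof (induction rule: converse_tranclp_induct)
    case (base a)
    then obtain w where w: "a \<in> C w" "u \<in> C w" "R w a u" by blast
    then have "a \<sqsubseteq> u" using le_of_block by blast
    then show ?case using new[OF _ w] base block.refl unfolding glued_le_def by blast
  next
    case (step a b)
    then obtain w where w: "a \<in> C w" "b \<in> C w" "R w a b" by blast
    then have ab: "a \<sqsubseteq> b" using le_of_block by blast
    show ?case
    proof (cases "b \<in> C x")
      case True
      then have "R x a b" using ab block_le step by blast
      then show ?thesis using step True block.trans[of x a b] by blast
    next
      case False
      have "a \<sqsubseteq> u" using ab step(2) le_trans unfolding glued_le_def by blast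
      then show ?thesis using new[OF _ w] False step block.refl unfolding glued_le_def by blast
    qed
  qed
qed

text \<open>If \<open>u\<close> lies outside the block of \<open>x\<close>, paths from \<open>a\<close> and \<open>p\<close> to \<open>u\<close> leave that
  block through higher blocks \<open>y\<close> and \<open>y'\<close>. Joining the points of departure with the least element
  of the block of \<open>y \<squnion> y'\<close>, by induction within \<open>y\<close> and \<open>y'\<close>, moves both into that block
  without leaving the block of \<open>x\<close>, and the induction hypothesis applies again.\<close>
lemma block_join_least:
  assumes "a \<in> C x" "p \<in> C x" "a \<sqsubseteq> u" "p \<sqsubseteq> u"
  shows "join_on (C x) (R x) a p \<sqsubseteq> u"
  using assms
proof (induction x arbitrary: a p rule: index_induct)
  case (less x)
  show ?case
  proof (cases "u \<in> C x")
    case True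
    then have "R x (join_on (C x) (R x) a p) u"
      using less block_le by (intro block.join_least) auto
    then show ?thesis by (rule le_of_block[OF block.join_closed[OF less(2,3)] True])
  next
    case False
    obtain y c where y: "x \<prec> y" and c: "c \<in> C x" "c \<in> C y" "R x a c" "c \<sqsubseteq> u"
      using leaving_block[OF less(4,2) False] by blast
    obtain y' d where y': "x \<prec> y'" and d: "d \<in> C x" "d \<in> C y'" "R x p d" "d \<sqsubseteq> u"
      using leaving_block[OF less(5,3) False] by blast
    let ?z = "y \<squnion> y'" and ?s = "join_on (C x) (R x) c d"
    have ord: "x \<preceq> y" "x \<preceq> y'" "y \<preceq> ?z" "y' \<preceq> ?z" using y y' by (auto simp: less_le)
    have xz: "x \<prec> ?z" "x \<preceq> ?z" using y ord less_le_trans less_imp_le by blast+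
    have s: "?s \<in> C x" "R x c ?s" "R x d ?s" using c d by auto
    have sy: "?s \<in> C y" "?s \<in> C y'"
      using filter_up[OF ord(1) c(1,2) s(1,2)] filter_up[OF ord(2) d(1,2) s(1,3)] by auto
    then have sz: "?s \<in> C ?z" using overlap_sup by blast
    then have ne: "C ?z \<noteq> {}" "C y \<noteq> {}" "C y' \<noteq> {}" using c d by auto
    let ?b = "bot ?z"
    have b: "?b \<in> C ?z" using bot_closed ne by blast
    have bs: "?b \<sqsubseteq> ?s" using le_of_block[OF b sz bot_least[OF ne(1) sz]] .
    have bb: "?b \<in> C y" "?b \<in> C y'"
      using block_convex[OF bot_mono[OF ord(3) b ne(2)] bs bot_closed[OF ne(2)] sy(1)]
        block_convex[OF bot_mono[OF ord(4) b ne(3)] bs bot_closed[OF ne(3)] sy(2)] by auto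
    have "bot y \<in> C x"
      using ideal_down[OF ord(1) c(1,2) bot_closed[OF ne(2)] bot_least[OF ne(2) c(2)]] .
    then have bx: "?b \<in> C x"
      using block_convex[OF bot_mono[OF ord(3) b ne(2)] bs] s by blast
    \<comment> \<open>\<open>u\<close> lies in the block of \<open>w \<squnion> w'\<close>, an index
      above \<open>?z\<close>, so the least element \<open>?b\<close> is below
      \<open>u\<close>.\<close>
    obtain w where w: "y \<preceq> w" "u \<in> C w" using le_obtains_index[OF c(4,2)] by blast
    obtain w' where w': "y' \<preceq> w'" "u \<in> C w'" using le_obtains_index[OF d(4,2)] by blast
    have "?z \<preceq> w \<squnion> w'" using w w' by (simp add: le_supI1 le_supI2)
    then have bu: "?b \<sqsubseteq> u" using bot_mono overlap_sup w w' ne by blast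
    let ?c = "join_on (C y) (R y) c ?b" and ?d = "join_on (C y') (R y') d ?b"
    have c': "?c \<in> C y" "R y c ?c" "R y ?b ?c" using c bb by auto
    have d': "?d \<in> C y'" "R y' d ?d" "R y' ?b ?d" using d bb by auto
    have cu: "?c \<sqsubseteq> u" using less(1)[OF y c(2) bb(1) c(4) bu] .
    have du: "?d \<sqsubseteq> u" using less(1)[OF y' d(2) bb(2) d(4) bu] .
    have cx: "?c \<in> C x" using ideal_join[OF ord(1) c(1,2) bx bb(1)] .
    have dx: "?d \<in> C x" using ideal_join[OF ord(2) d(1,2) bx bb(2)] .
    have cz: "?c \<in> C ?z" using filter_up[OF ord(3) bb(1) b c'(1,3)] .
    have dz: "?d \<in> C ?z" using filter_up[OF ord(4) bb(2) b d'(1,3)] .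
    \<comment> \<open>\<open>?t\<close> is below \<open>u\<close> by induction, and in
      \<open>C x\<close> by the ideal property. As an upper bound of \<open>a\<close> and
      \<open>p\<close> in \<open>C x\<close> it is above their join there.\<close>
    let ?t = "join_on (C ?z) (R ?z) ?c ?d"
    have tu: "?t \<sqsubseteq> u" using less(1)[OF xz(1) cz dz cu du] .
    have tx: "?t \<in> C x" using ideal_join[OF xz(2) cx cz dx dz] .
    have t: "?t \<in> C ?z" "R ?z ?c ?t" "R ?z ?d ?t" using cz dz by auto
    have "a \<sqsubseteq> ?c" using le_trans le_of_block[OF less(2) c(1,3)] le_of_block[OF c(2) c'(1,2)] by blast
    then have at: "a \<sqsubseteq> ?t" using le_trans le_of_block[OF cz t(1,2)] by blast
    have "p \<sqsubseteq> ?d" using le_trans le_of_block[OF less(3) d(1,3)] le_of_block[OF d(2) d'(1,2)] by blast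
    then have pt: "p \<sqsubseteq> ?t" using le_trans le_of_block[OF dz t(1,3)] by blast
    have apt: "R x (join_on (C x) (R x) a p) ?t"
      using at pt tx less(2,3) block_le by (intro block.join_least) auto
    show ?thesis
      by (rule le_trans[OF le_of_block[OF block.join_closed[OF less(2,3)] tx apt] tu])
  qed
qed

lemma block_lub:
  assumes "a \<in> C x" "b \<in> C x"
  shows "is_lub_on L (\<sqsubseteq>) a b (join_on (C x) (R x) a b)"
  using assms block_join_least[OF assms] le_of_block[of _ x] unfolding is_lub_on_def L_iff
  by (metis block.join_closed block.join_ge1 block.join_ge2)

text \<open>Climb from \<open>x\<close> to \<open>z\<close>, joining with the least element of the
  next block at each step. By \<open>bot_mono\<close> these least elements are below every
  \<open>u\<close> in a block above \<open>z\<close>, so the result stays below each such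
  \<open>u\<close> that bounds \<open>a\<close>.\<close>

lemma raise:
  assumes "x \<preceq> z" "a \<in> C x"
  shows "\<exists>c\<in>C z. a \<sqsubseteq> c \<and> (\<forall>w u. z \<preceq> w \<longrightarrow> u \<in> C w \<longrightarrow> a \<sqsubseteq> u \<longrightarrow> c \<sqsubseteq> u)"
  using assms
proof (induction x arbitrary: a rule: index_induct)
  case (less x)
  show ?case
  proof (cases "x = z")
    case True
    then show ?thesis using less le_refl L_iff by blast
  next
    case False
    then have "x \<prec> z" using less by (simp add: less_le)
    then obtain x' where x': "x \<prec> x'" "x' \<preceq> z" "C x \<inter> C x' \<noteq> {}" by (rule index_step)
    then obtain e where e: "e \<in> C x" "e \<in> C x'" by blast
    then have ne: "C x' \<noteq> {}" by blast
    have xx': "x \<preceq> x'" using x' by (simp add: less_le)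
    have b: "bot x' \<in> C x" "bot x' \<in> C x'"
      using ideal_down[OF xx' e bot_closed[OF ne] bot_least[OF ne e(2)]] bot_closed[OF ne] by auto
    let ?a = "join_on (C x) (R x) a (bot x')"
    have a: "?a \<in> C x" "R x a ?a" "R x (bot x') ?a" using b less by auto
    have "?a \<in> C x'" using filter_up[OF xx' b a(1,3)] .
    then obtain c where c: "c \<in> C z" "?a \<sqsubseteq> c"
        "\<forall>w u. z \<preceq> w \<longrightarrow> u \<in> C w \<longrightarrow> ?a \<sqsubseteq> u \<longrightarrow> c \<sqsubseteq> u"
      using less(1)[OF x'(1,2)] by blast
    have "a \<sqsubseteq> c" using le_trans[OF le_of_block c(2)] less a by blast
    moreover have "c \<sqsubseteq> u" if "z \<preceq> w" "u \<in> C w" "a \<sqsubseteq> u" for w u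
    proof -
      have "bot x' \<sqsubseteq> u" using bot_mono[OF order_trans[OF x'(2) that(1)] that(2) ne] .
      then have "?a \<sqsubseteq> u" using block_join_least less b that by blast
      then show ?thesis using c that by blast
    qed
    ultimately show ?thesis using c by blast
  qed
qed

text \<open>Both elements are raised to the block of \<open>x \<squnion> y\<close> and joined there.
  A common upper bound lies in a block above that index, hence bounds the raised elements
  too.\<close>

lemma ex_lub:
  assumes "a \<in> L" "b \<in> L"
  shows "\<exists>c. is_lub_on L (\<sqsubseteq>) a b c"
proof -
  obtain x y where x: "a \<in> C x" and y: "b \<in> C y" using assms L_iff by blast
  let ?z = "x \<squnion> y"
  obtain c where c: "c \<in> C ?z" "a \<sqsubseteq> c" "\<forall>w u. ?z \<preceq> w \<longrightarrow> u \<in> C w \<longrightarrow> a \<sqsubseteq> u \<longrightarrow> c \<sqsubseteq> u"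
    using raise[OF sup_ge1 x] by blast
  obtain d where d: "d \<in> C ?z" "b \<sqsubseteq> d" "\<forall>w u. ?z \<preceq> w \<longrightarrow> u \<in> C w \<longrightarrow> b \<sqsubseteq> u \<longrightarrow> d \<sqsubseteq> u"
    using raise[OF sup_ge2 y] by blast
  have lub: "is_lub_on L (\<sqsubseteq>) c d (join_on (C ?z) (R ?z) c d)" (is "is_lub_on _ _ _ _ ?j")
    by (rule block_lub[OF c(1) d(1)])
  have "?j \<sqsubseteq> u" if u: "a \<sqsubseteq> u" "b \<sqsubseteq> u" for u
  proof -
    obtain w where w: "x \<preceq> w" "u \<in> C w" using le_obtains_index u x by blast
    obtain w' where w': "y \<preceq> w'" "u \<in> C w'" using le_obtains_index u y by blast
    have "?z \<preceq> w \<squnion> w'" using w w' by (simp add: le_supI1 le_supI2)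
    moreover have "u \<in> C (w \<squnion> w')" using overlap_sup w w' by blast
    ultimately have "c \<sqsubseteq> u" "d \<sqsubseteq> u" using c d u by blast+
    then show ?thesis using lub le_closed unfolding is_lub_on_def by blast
  qed
  then have "is_lub_on L (\<sqsubseteq>) a b ?j"
    using lub c d le_trans unfolding is_lub_on_def by blast
  then show ?thesis by blast
qed

sublocale sum: carrier_lattice L "(\<sqsubseteq>)"
proof
  have "\<exists>c. is_glb_on L (\<sqsubseteq>) a b c" if "a \<in> L" "b \<in> L" for a b
    using glued.ex_lub[OF dual that] unfolding le_dual is_lub_on_dual[of L "(\<sqsubseteq>)"] .
  then show "lattice_on L (\<sqsubseteq>)"
    unfolding lattice_on_def partial_order_on'_def
    using ex_lub le_refl le_antisym le_trans by blast
qed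

lemma block_join: "a \<in> C x \<Longrightarrow> b \<in> C x \<Longrightarrow> join_on (C x) (R x) a b = join_on L (\<sqsubseteq>) a b"
  using sum.join_eqI[OF block_lub] by simp

lemma block_Join:
  assumes "finite X" "X \<noteq> {}" "X \<subseteq> C x"
  shows "block.Join x X = sum.Join X"
proof -
  have "big_join_on (C x) (R x) xs = big_join_on L (\<sqsubseteq>) xs \<and> big_join_on L (\<sqsubseteq>) xs \<in> C x"
    if "xs \<noteq> []" "set xs \<subseteq> C x" for xs
    using that
  proof (induction xs rule: induct_list012)
    case (3 a b xs)
    then have "big_join_on (C x) (R x) (b # xs) = big_join_on L (\<sqsubseteq>) (b # xs)"
        "big_join_on L (\<sqsubseteq>) (b # xs) \<in> C x" "a \<in> C x"
      by auto
    then show ?case using block_join[of a x] block.join_closed[of a x] by simp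
  qed auto
  moreover obtain xs where "set xs = X" using finite_list[OF assms(1)] by blast
  ultimately show ?thesis
    using assms block.big_join_eq_Join[of xs x] sum.big_join_eq_Join[of xs] L_iff by fastforce
qed

section \<open>Chain conditions, covers and local modularity of the glued sum\<close>

lemma sum_acc: "wfp (strict_on L (\<lambda>a b. b \<sqsubseteq> a))"
  unfolding wfp_eq_minimal
proof (intro allI impI)
  fix Q and q :: 'a
  assume "q \<in> Q"
  show "\<exists>a\<in>Q. \<forall>b. strict_on L (\<lambda>a b. b \<sqsubseteq> a) b a \<longrightarrow> b \<notin> Q"
  proof (cases "q \<in> L")
    case False
    then show ?thesis using \<open>q \<in> Q\<close> by (auto simp: strict_on_def)
  next
    case True
    then obtain x0 where "Q \<inter> C x0 \<noteq> {}" using \<open>q \<in> Q\<close> L_iff by blast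
    \<comment> \<open>First a maximal index whose block meets \<open>Q\<close>, then a maximal
      \<open>a\<close> in that intersection. Rerouting places any element of \<open>Q\<close> above
      \<open>a\<close> in a block at or above \<open>x\<close>, hence in \<open>C x\<close>
      itself.\<close>
    then obtain x where x: "Q \<inter> C x \<noteq> {}" and x_max: "\<And>y. x \<prec> y \<Longrightarrow> Q \<inter> C y = {}"
      using index_maximal[of "\<lambda>x. Q \<inter> C x \<noteq> {}"] by blast
    obtain a where a: "a \<in> Q \<inter> C x"
        and a_max: "\<And>b. strict_on (C x) (\<lambda>a b. R x b a) b a \<Longrightarrow> b \<notin> Q \<inter> C x"
      using x block_acc[of x] unfolding wfp_eq_minimal by (metis ex_in_conv)
    have "b \<notin> Q" if ab: "strict_on L (\<lambda>a b. b \<sqsubseteq> a) b a" for b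
    proof
      assume "b \<in> Q"
      obtain y where y: "x \<preceq> y" "b \<in> C y" "b \<in> C x \<longrightarrow> R x a b"
        using le_obtains_index[of a b x] ab a by (auto simp: strict_on_def)
      then have "y = x" using x_max[of y] \<open>b \<in> Q\<close> by (auto simp: less_le)
      then show False using y a a_max[of b] ab \<open>b \<in> Q\<close> by (auto simp: strict_on_def)
    qed
    then show ?thesis using a by blast
  qed
qed

text \<open>Take \<open>x\<close> maximal with \<open>d\<close> in its block. A chain from
  \<open>d\<close> to a cover outside \<open>C x\<close> would depart from \<open>C x\<close> at a
  point shared with a higher block; that point is \<open>d\<close> or the cover, and both are
  impossible.\<close>

lemma block_of_covers:
  assumes "d \<in> L"
  shows "\<exists>x. d \<in> C x \<and> (\<forall>a. sum.cover d a \<longrightarrow> a \<in> C x)"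
proof -
  obtain x0 where "d \<in> C x0" using assms L_iff by blast
  then obtain x where x: "d \<in> C x" and x_max: "\<And>y. x \<prec> y \<Longrightarrow> d \<notin> C y"
    using index_maximal[of "\<lambda>x. d \<in> C x"] by blast
  have "a \<in> C x" if "sum.cover d a" for a
  proof (rule ccontr)
    assume "a \<notin> C x"
    note da = sum.coverD[OF that]
    obtain y c where y: "x \<prec> y" and c: "c \<in> C x" "c \<in> C y" "R x d c" "c \<sqsubseteq> a"
      using leaving_block[OF da(3) x \<open>a \<notin> C x\<close>] by blast
    then have "c = d \<or> c = a" using da(5)[of c] le_of_block x L_iff by blast
    then show False using x_max[OF y] c \<open>a \<notin> C x\<close> by blast
  qed
  then show ?thesis using x by blast
qed

text \<open>\<open>a\<close> and \<open>b\<close> lie in one block with \<open>d\<close>, and by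
  convexity so does any \<open>e\<close> between \<open>a\<close> and the join. Modularity writes
  \<open>e\<close> as the join of \<open>a\<close> with the meet of \<open>b\<close> and
  \<open>e\<close>, and that meet is \<open>d\<close> or \<open>b\<close>.\<close>

lemma cover_join:
  assumes mod: "\<And>x. modular_on (C x) (R x)"
    and cov: "sum.cover d a" "sum.cover d b" and "a \<noteq> b"
  shows "sum.cover a (join_on L (\<sqsubseteq>) a b)"
proof -
  note da = sum.coverD[OF cov(1)] and db = sum.coverD[OF cov(2)]
  obtain x where d: "d \<in> C x" and x: "\<And>a. sum.cover d a \<Longrightarrow> a \<in> C x"
    using block_of_covers[OF da(1)] by blast
  have a: "a \<in> C x" and b: "b \<in> C x" using x cov by auto
  let ?j = "join_on (C x) (R x) a b"
  have j: "?j \<in> C x" "R x a ?j" "R x b ?j" using a b by auto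
  have "a \<noteq> ?j"
  proof
    assume "a = ?j"
    then have "b \<sqsubseteq> a" using j b a le_of_block by metis
    then show False using da(5)[OF db(2,3)] db(4) \<open>a \<noteq> b\<close> by blast
  qed
  moreover have "e = a \<or> e = ?j" if e: "a \<sqsubseteq> e" "e \<sqsubseteq> ?j" for e
  proof -
    have ex: "e \<in> C x" using block_convex[OF e a j(1)] .
    let ?m = "meet_on (C x) (R x) b e"
    have m: "?m \<in> C x" "R x ?m b" "R x ?m e" using b ex by auto
    have "R x d ?m"
      using le_trans[OF da(3) e(1)] db(3) d b ex block_le by (intro block.meet_greatest) auto
    then have "?m = d \<or> ?m = b" using db(5)[of ?m] le_of_block m d b L_iff by blast
    moreover have "join_on (C x) (R x) a ?m = meet_on (C x) (R x) ?j e"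
      using mod[of x] a b ex e(1) block_le unfolding modular_on_def by blast
    moreover have "meet_on (C x) (R x) ?j e = e"
      using block.meet_absorb[of x e ?j] block.meet_commute[of x e ?j] ex j e(2) block_le by simp
    moreover have "join_on (C x) (R x) a d = a"
      using block.join_absorb[of x d a] block.join_commute[of x d a] a d da(3) block_le by simp
    ultimately show ?thesis by auto
  qed
  ultimately show ?thesis
    using a b j le_of_block L_iff unfolding block_join[OF a b, symmetric] sum.cover_def strict_on_def
    by blast
qed

lemma modular_on_dual:
  assumes "modular_on (C x) (R x)"
  shows "modular_on (C x) (\<lambda>a b. R x b a)"
  unfolding modular_on_def join_on_dual[of "C x" "R x"] meet_on_dual[of "C x" "R x"]
proof (intro ballI impI)
  fix a b c assume A: "a \<in> C x" "b \<in> C x" "c \<in> C x" "R x c a"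
  have "join_on (C x) (R x) c (meet_on (C x) (R x) b a) = meet_on (C x) (R x) (join_on (C x) (R x) c b) a"
    using assms A unfolding modular_on_def by blast
  then show "meet_on (C x) (R x) a (join_on (C x) (R x) b c) = join_on (C x) (R x) (meet_on (C x) (R x) a b) c"
    using block.join_commute[of x] block.meet_commute[of x] by metis
qed

lemma local_modular_sum:
  assumes "\<And>x. modular_on (C x) (R x)"
  shows "local_modular_lattice L (\<sqsubseteq>)"
proof
  show "wfp (strict_on L (\<lambda>a b. b \<sqsubseteq> a))" by (rule sum_acc)
  show "wfp (strict_on L (\<sqsubseteq>))" using glued.sum_acc[OF dual] unfolding le_dual .
  show "sum.cover a (join_on L (\<sqsubseteq>) a b)" if "sum.cover d a" "sum.cover d b" "a \<noteq> b" for d a b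
    using cover_join assms that by blast
  show "sum.cover (meet_on L (\<sqsubseteq>) a b) a" if "sum.cover a d" "sum.cover b d" "a \<noteq> b" for d a b
    using glued.cover_join[OF dual, of d a b] modular_on_dual assms that
    unfolding le_dual sum.cover_dual join_on_dual[of L "(\<sqsubseteq>)"] by blast
qed

text \<open>All elements involved lie in one block, where the identity at \<open>x = p\<close> would
  read \<open>p = d\<close>, every partial meet being \<open>d\<close>.\<close>

lemma atoms_not_minimally_spanned:
  assumes n: "n \<ge> 1" and nd: "\<And>x. n_distributive_on (C x) (R x) n"
    and p: "sum.cover d p" and y: "\<forall>i\<le>n. sum.cover d (y i)"
  shows "\<not> sum.minimally_spanned n d p y"
proof
  assume span: "sum.minimally_spanned n d p y"
  note dp = sum.coverD[OF p]
  obtain x where d: "d \<in> C x" and x: "\<And>a. sum.cover d a \<Longrightarrow> a \<in> C x"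
    using block_of_covers[OF dp(1)] by blast
  have px: "p \<in> C x" and yx: "\<And>i. i \<le> n \<Longrightarrow> y i \<in> C x" using x p y by auto
  let ?Y = "\<lambda>I. sum.Join (y ` I)"
  have J: "block.Join x (y ` I) = ?Y I \<and> ?Y I \<in> C x" if "I \<subseteq> {..n}" "I \<noteq> {}" for I
  proof -
    have fin: "finite I" using that finite_subset by blast
    have y_in: "y i \<in> C x" if "i \<in> I" for i using \<open>I \<subseteq> {..n}\<close> that yx by auto
    have "block.Join x (y ` I) = ?Y I"
      by (rule block_Join) (use fin y_in that in auto)
    moreover have "block.Join x (y ` I) \<in> C x"
      by (rule block.JOIN_closed[OF fin that(2) y_in])
    ultimately show ?thesis by simp
  qed
  have Y: "block.Join x (y ` {..n}) = ?Y {..n}" "?Y {..n} \<in> C x" using J[of "{..n}"] by auto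
  have Yj: "block.Join x (y ` ({..n} - {j})) = ?Y ({..n} - {j})" "?Y ({..n} - {j}) \<in> C x" for j
    using J[of "{..n} - {j}"] others_nonempty[OF n] by auto
  have "meet_on (C x) (R x) p (?Y ({..n} - {j})) = d" if "j \<le> n" for j
  proof -
    let ?m = "meet_on (C x) (R x) p (?Y ({..n} - {j}))"
    have m: "?m \<in> C x" "R x ?m p" "R x ?m (?Y ({..n} - {j}))" using px Yj by auto
    obtain i where i: "i \<in> {..n} - {j}" using others_nonempty[OF n, of j] by blast
    have "R x d (block.Join x (y ` ({..n} - {j})))"
      by (rule block.JOIN_le_trans[OF _ _ i])
        (use i d yx y sum.coverD(3) block_le in auto)
    then have "R x d ?m"
      using d px Yj dp(3) block_le by (intro block.meet_greatest) auto
    then have "?m = d \<or> ?m = p" using dp(5)[of ?m] le_of_block m d px L_iff by blast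
    moreover have "?m \<noteq> p"
      using m(3) span that px Yj(2)[of j] block_le by (auto simp: sum.minimally_spanned_def)
    ultimately show ?thesis by blast
  qed
  then have "(\<lambda>j. meet_on (C x) (R x) p (block.Join x (y ` ({..n} - {j})))) ` {..n} = {d}"
    using Yj(1) by (auto simp: image_iff)
  moreover have "meet_on (C x) (R x) p (block.Join x (y ` {..n})) =
      block.Join x ((\<lambda>j. meet_on (C x) (R x) p (block.Join x (y ` ({..n} - {j})))) ` {..n})"
    using block.n_distributive_identity[OF n px, of y] nd[of x] px yx
    unfolding n_distributive_on_def by blast
  moreover have "meet_on (C x) (R x) p (block.Join x (y ` {..n})) = p"
    using span px Y block_le by (intro block.meet_absorb) (auto simp: sum.minimally_spanned_def)
  moreover have "block.Join x {d} = d"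
    using d by (intro block.Join_eqI) (auto simp: block.lub_def)
  ultimately show False using dp(4) by simp
qed

theorem n_distributive_sum:
  assumes "n \<ge> 1" "\<And>x. n_distributive_on (C x) (R x) n"
  shows "n_distributive_on L (\<sqsubseteq>) n"
proof -
  interpret local_modular_lattice L "(\<sqsubseteq>)"
    by (rule local_modular_sum) (use assms in \<open>auto simp: n_distributive_on_def\<close>)
  show ?thesis
    by (rule n_distributive_onI[OF assms(1)]) (rule atoms_not_minimally_spanned[OF assms])
qed

end

section \<open>From \<open>glued_system\<close> to the elementwise axioms of the locale\<close>

lemma glued_of_glued_system:
  fixes C :: "'s::lattice \<Rightarrow> 'a set"
  assumes "finite_length_on (UNIV :: 's set) (\<le>)" and G: "glued_system C R"
  shows "glued inf (\<le>) (<) sup C R"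
proof (intro glued.intro glued_axioms.intro)
  have blocks: "\<forall>x. lattice_on (C x) (R x) \<and> finite_length_on (C x) (R x)"
    and fi: "\<forall>x y. x \<le> y \<and> C x \<inter> C y \<noteq> {} \<longrightarrow>
        is_filter_on (C x) (R x) (C x \<inter> C y) \<and> is_ideal_on (C y) (R y) (C x \<inter> C y)"
    and agree: "\<forall>x y. x \<le> y \<and> C x \<inter> C y \<noteq> {} \<longrightarrow>
        (\<forall>a\<in>C x \<inter> C y. \<forall>b\<in>C x \<inter> C y. R x a b \<longleftrightarrow> R y a b)"
    and adjacent: "\<forall>x y. covers x y \<longrightarrow> C x \<inter> C y \<noteq> {}"
    and overlap: "\<forall>x y. C x \<inter> C y \<subseteq> C (inf x y) \<inter> C (sup x y)"
    by (insert G[unfolded glued_system_def], (elim conjE, assumption)+)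
  have filter: "is_filter_on (C x) (R x) (C x \<inter> C y)" and ideal: "is_ideal_on (C y) (R y) (C x \<inter> C y)"
    if "x \<le> y" "a \<in> C x" "a \<in> C y" for x y a
    using fi that by blast+
  show "class.lattice inf (\<le>) (<) (sup :: 's \<Rightarrow> 's \<Rightarrow> 's)" by (rule lattice_class.lattice_axioms)
  show "finite_length_on (UNIV :: 's set) (\<le>)" by fact
  show "lattice_on (C x) (R x)" "finite_length_on (C x) (R x)" for x
    using blocks by blast+
  show "C x \<inter> C y \<noteq> {}" if "x < y" "\<And>z. x < z \<Longrightarrow> \<not> z < y" for x y
    using adjacent that unfolding covers_def by blast
  show "x \<le> y \<Longrightarrow> a \<in> C x \<Longrightarrow> a \<in> C y \<Longrightarrow> b \<in> C x \<Longrightarrow> R x a b \<Longrightarrow> b \<in> C y" for x y a b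
    using filter unfolding is_filter_on_def by blast
  show "x \<le> y \<Longrightarrow> a \<in> C x \<Longrightarrow> a \<in> C y \<Longrightarrow> b \<in> C y \<Longrightarrow> R y b a \<Longrightarrow> b \<in> C x" for x y a b
    using ideal unfolding is_ideal_on_def by blast
  show "x \<le> y \<Longrightarrow> a \<in> C x \<Longrightarrow> a \<in> C y \<Longrightarrow> b \<in> C x \<Longrightarrow> b \<in> C y \<Longrightarrow>
      meet_on (C x) (R x) a b \<in> C y" for x y a b
    using filter unfolding is_filter_on_def by blast
  show "x \<le> y \<Longrightarrow> a \<in> C x \<Longrightarrow> a \<in> C y \<Longrightarrow> b \<in> C x \<Longrightarrow> b \<in> C y \<Longrightarrow>
      join_on (C y) (R y) a b \<in> C x" for x y a b
    using ideal unfolding is_ideal_on_def by blast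
  show "x \<le> y \<Longrightarrow> a \<in> C x \<Longrightarrow> a \<in> C y \<Longrightarrow> b \<in> C x \<Longrightarrow> b \<in> C y \<Longrightarrow> R x a b = R y a b" for x y a b
    using agree by blast
  show "a \<in> C x \<Longrightarrow> a \<in> C y \<Longrightarrow> a \<in> C (inf x y)" "a \<in> C x \<Longrightarrow> a \<in> C y \<Longrightarrow> a \<in> C (sup x y)" for x y a
    using overlap by blast+
qed

theorem theorem3p4:
  fixes C :: "'s::lattice \<Rightarrow> 'a set"
    and R :: "'s \<Rightarrow> 'a \<Rightarrow> 'a \<Rightarrow> bool"
    and n :: nat
  assumes "finite_length_on (UNIV :: 's set) (\<le>)"
    and "glued_system C R"
    and "n \<ge> 1"
    and "\<forall>x. n_distributive_on (C x) (R x) n"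
  shows "n_distributive_on (glued_carrier C) (glued_le C R) n"
  using glued.n_distributive_sum[OF glued_of_glued_system[OF assms(1,2)]] assms(3,4) by blast

end
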